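(* There exist constants $c_1,c_2,c_3,c_4\in\mathbb R\setminus\{0\}$, all greater than $-2$, with $c_2>c_1$ and $c_4>c_3$, such that for all integers $p\ge2$ $$6\,\frac{\sqrt{p+c_2}}{(p+c_4)^{3/2}}\ \le\ \nu_p\ \le\ 6\,\frac{\sqrt{p+c_1}}{(p+c_3)^{3/2}},$$ and there exist constants $d_1,d_2,d_3,d_4\in\mathbb R\setminus\{0\}$, all greater than $-2$, with $d_2>d_1$ and $d_4>d_3$, such that for all integers $p\ge 2$ $$\frac{\sqrt{(p+d_2)(p+d_3)}}{24}\ \le\ u_p\ \le\ \frac{\sqrt{(p+d_1)(p+d_4)}}{24}.$$ As a result, with these constants, for all integers $p\ge2$, $$\frac14\cdot\frac{\sqrt{(p+d_2)(p+d_3)(p+c_2)}}{(p+c_4)^{3/2}}\ \le\ U(\operatorname{rect}^{\{p\}})\ \le\ \frac14\cdot\frac{\sqrt{(p+d_1)(p+d_4)(p+c_1)}}{(p+c_3)^{3/2}}.$$ In particular, $\lim_{p\to+\infty}U(\operatorname{rect}^{\{p\}})=\frac14$, and this limit is the infimum of $U(\operatorname{rect}^{\{p\}})$ over $p$.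
   Context: $\operatorname{rect}^{\{1\}}=\operatorname{rect}=\mathbf 1_{[-1/2,1/2]}$ and, for $p\ge2$, $\operatorname{rect}^{\{p\}}(x)=\int_{x-1/2}^{x+1/2}\operatorname{rect}^{\{p-1\}}(s)\,ds$; it is supported in $[-p/2,p/2]$. Define $$\nu_p=\frac{\int_{\mathbb R}\omega^2\left(\frac{\sin(\omega/2)}{\omega/2}\right)^{2p}d\omega}{\int_{\mathbb R}\left(\frac{\sin(\omega/2)}{\omega/2}\right)^{2p}d\omega},\qquad u_p=\frac{\int_{-p/2}^{p/2}x^2|\operatorname{rect}^{\{p\}}(x)|^2dx}{\int_{-p/2}^{p/2}|\operatorname{rect}^{\{p\}}(x)|^2dx}.$$ For a nonzero compactly supported $f\in L^2(\mathbb R)$, with $\|\cdot\|$ the $L^2$ norm and $\hat f(\omega)=\int_{\mathbb R}e^{-i\omega x}f(x)\,dx$, set $\alpha[f]=\frac1{\|f\|^2}\int x|f(x)|^2dx$, $\sigma_x^2[f]=\frac1{\|f\|^2}\int (x-\alpha[f])^2|f(x)|^2dx$, $\beta[\hat f]=\frac1{2\pi\|f\|^2}\int_{\mathbb R}\omega|\hat f(\omega)|^2d\omega$, $\sigma_\omega^2[\hat f]=\frac1{2\pi\|f\|^2}\int_{\mathbb R}(\omega-\beta[\hat f])^2|\hat f(\omega)|^2d\omega$, and $U(f)=\sigma_x^2[f]\,\sigma_\omega^2[\hat f]$. For $p\ge2$ one has $U(\operatorname{rect}^{\{p\}})=\nu_p\,u_p$. *)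

theory Defs
  imports "HOL-Analysis.Analysis"
begin

text \<open>
  \<^term>\<open>rect p\<close> is only meaningful for \<open>p \<ge> 1\<close>; the value at \<open>p = 0\<close> is a dummy.
\<close>

fun rect :: "nat \<Rightarrow> real \<Rightarrow> real" where
  "rect 0 x = 0"
| "rect (Suc 0) x = indicator {-1/2..1/2} x"
| "rect (Suc (Suc p)) x = (LBINT s:{x - 1/2..x + 1/2}. rect (Suc p) s)"

text \<open>
  The integrands below are only affected on a null set by the convention \<open>0 / 0 = 0\<close> at
  \<open>\<omega> = 0\<close>. The numerator is integrable for \<open>p \<ge> 2\<close> only.
\<close>

definition nu :: "nat \<Rightarrow> real" where
  "nu p = (LBINT \<omega>. \<omega>\<^sup>2 * (sin (\<omega> / 2) / (\<omega> / 2)) ^ (2 * p))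
        / (LBINT \<omega>. (sin (\<omega> / 2) / (\<omega> / 2)) ^ (2 * p))"

definition u :: "nat \<Rightarrow> real" where
  "u p = (LBINT x:{- real p / 2..real p / 2}. x\<^sup>2 * \<bar>rect p x\<bar>\<^sup>2)
       / (LBINT x:{- real p / 2..real p / 2}. \<bar>rect p x\<bar>\<^sup>2)"

text \<open>
  The following are intended for (Borel representatives of) nonzero compactly supported
  \<open>f \<in> L\<^sup>2(\<real>)\<close>. As the Bochner integral of a non-integrable function is \<open>0\<close>, the values of
  \<open>beta\<close>, \<open>var_freq\<close> and \<open>U\<close> are not meaningful if \<open>\<omega>\<^sup>2 |fourier f \<omega>|\<^sup>2\<close> is not integrable;
  among the functions \<open>rect p\<close> with \<open>p \<ge> 1\<close> this concerns only \<open>p = 1\<close>. Both \<open>beta\<close> and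
  \<open>var_freq\<close> take \<open>f\<close> instead of its transform as argument.
\<close>

definition L2norm :: "(real \<Rightarrow> complex) \<Rightarrow> real" where
  "L2norm f = sqrt (LBINT x. (cmod (f x))\<^sup>2)"

definition fourier :: "(real \<Rightarrow> complex) \<Rightarrow> real \<Rightarrow> complex" where
  "fourier f \<omega> = (LBINT x. exp (- \<i> * complex_of_real \<omega> * complex_of_real x) * f x)"

definition alpha :: "(real \<Rightarrow> complex) \<Rightarrow> real" where
  "alpha f = 1 / (L2norm f)\<^sup>2 * (LBINT x. x * (cmod (f x))\<^sup>2)"

definition var_time :: "(real \<Rightarrow> complex) \<Rightarrow> real" where
  "var_time f = 1 / (L2norm f)\<^sup>2 * (LBINT x. (x - alpha f)\<^sup>2 * (cmod (f x))\<^sup>2)"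

definition beta :: "(real \<Rightarrow> complex) \<Rightarrow> real" where
  "beta f = 1 / (2 * pi * (L2norm f)\<^sup>2) * (LBINT \<omega>. \<omega> * (cmod (fourier f \<omega>))\<^sup>2)"

definition var_freq :: "(real \<Rightarrow> complex) \<Rightarrow> real" where
  "var_freq f = 1 / (2 * pi * (L2norm f)\<^sup>2)
     * (LBINT \<omega>. (\<omega> - beta f)\<^sup>2 * (cmod (fourier f \<omega>))\<^sup>2)"

definition U :: "(real \<Rightarrow> complex) \<Rightarrow> real" where
  "U f = var_time f * var_freq f"

end

theory Submission
  imports Defs "HOL-Probability.Probability"
begin

text \<open>
  Write \<open>B p\<close> for \<open>rect p\<close>, the \<open>p\<close>-fold convolution power of the indicator function of
  \<open>[-1/2, 1/2]\<close>. The theorem follows from three explicit inequalities, valid for all \<open>p \<ge> 2\<close>: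
  \<open>nu p \<le> 6 / p\<close> (\<open>nu_le\<close>), \<open>u p \<le> (p + 1) / 24\<close> (\<open>u_le\<close>) and the uncertainty inequality
  \<open>nu p * u p \<ge> 1/4\<close> (\<open>nu_times_u_ge\<close>). Together they give \<open>nu p \<ge> 6 / (p + 1)\<close> and
  \<open>u p \<ge> p / 24\<close>, from which the constants are read off, and
  \<open>1/4 \<le> U (B p) \<le> (p + 1) / (4 * p)\<close>, which gives the limit and the infimum.

  All quantities are first expressed by values of B-splines. Since the Fourier transform of \<open>B p\<close> is
  the \<open>p\<close>-th power of \<open>hsinc\<close> away from \<open>0\<close>, Levy's inversion formula (\<open>rect_inversion\<close>) yields
  \<open>nu p = 2 * (B (2 p - 2) 0 - B (2 p - 2) 1) / B (2 p) 0\<close>. As multiplication by \<open>x\<close> is a derivation of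
  the convolution algebra, \<open>u p\<close> equals \<open>p\<^sup>2 / (2 p - 1)\<close> times the mean of \<open>t\<^sup>2\<close> on
  \<open>[-1/2, 1/2]\<close> with respect to the density proportional to \<open>B (2 p - 1)\<close>
  (\<open>integral_sq_times_rect_sq\<close>).

  Let \<open>g = - (B (2 p - 1))'\<close>, which is \<open>slope (2 p - 2)\<close>, an odd function. Integration by parts gives
  that \<open>B (2 p) 0\<close> is \<open>2 p\<close> times the integral of \<open>t * g t\<close> over \<open>[-1/2, 1/2]\<close>, while the numerator of
  \<open>nu p\<close> is \<open>2 * g (1/2)\<close>. The key point is that \<open>g t / t\<close> is nonincreasing for \<open>t > 0\<close>
  (\<open>ratio_antimono_slope\<close>); it is proved by induction from \<open>p\<close> to \<open>p + 1\<close>, that is, by two convolutions with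
  \<open>B 1\<close>. Hence \<open>t * g t \<ge> 2 * t\<^sup>2 * g (1/2)\<close> on the interval, and integration
  gives \<open>nu p \<le> 6 / p\<close>. It also follows that \<open>g \<ge> 0\<close> on the positive half-line, so \<open>B (2 p - 1)\<close> decreases
  there, and Chebyshev's inequality bounds the mean of \<open>t\<^sup>2\<close> by \<open>1/12\<close>. This gives the bound
  on \<open>u p\<close>.
\<close>

section \<open>The convolution algebra of bounded functions with bounded support\<close>

text \<open>
  Bounded Borel functions of bounded support. Under convolution they form a commutative
  algebra, and products of their translates are integrable, so Fubini's theorem applies freely.
\<close>

definition bcs :: "(real \<Rightarrow> real) \<Rightarrow> bool" where
  "bcs f \<longleftrightarrow> f \<in> borel_measurable borel \<and> (\<exists>K. \<forall>x. \<bar>f x\<bar> \<le> K) \<and>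
     (\<exists>R. \<forall>x. R < \<bar>x\<bar> \<longrightarrow> f x = 0)"

text \<open>
  Convolution on the real line.
\<close>

definition conv :: "(real \<Rightarrow> real) \<Rightarrow> (real \<Rightarrow> real) \<Rightarrow> real \<Rightarrow> real" where
  "conv f g x = (LBINT t. f t * g (x - t))"

lemma bcs_measurable: "bcs f \<Longrightarrow> f \<in> borel_measurable borel"
  by (simp add: bcs_def)

lemma bcsI:
  assumes "f \<in> borel_measurable borel" "\<And>x. \<bar>f x\<bar> \<le> K" "\<And>x. R < \<bar>x\<bar> \<Longrightarrow> f x = 0"
  shows "bcs f"
  using assms unfolding bcs_def by blast

lemma bcsE:
  assumes "bcs f"
  obtains K R where "0 \<le> K" "0 \<le> R" "\<And>x. \<bar>f x\<bar> \<le> K" "\<And>x. R < \<bar>x\<bar> \<Longrightarrow> f x = 0"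
proof -
  obtain K R where K: "\<And>x. \<bar>f x\<bar> \<le> K" and R: "\<And>x. R < \<bar>x\<bar> \<Longrightarrow> f x = 0"
    using assms unfolding bcs_def by blast
  show thesis
  proof (rule that[of K "max R 0"])
    show "0 \<le> K" using K[of 0] by linarith
  qed (use K R in auto)
qed

lemma integrable_bounded_support:
  fixes F :: "'a::euclidean_space \<Rightarrow> 'b::{banach, second_countable_topology}"
  assumes "F \<in> borel_measurable borel" "\<And>x. norm (F x) \<le> K" "bounded S" "\<And>x. x \<notin> S \<Longrightarrow> F x = 0"
  shows "integrable lborel F"
proof -
  obtain a where a: "S \<subseteq> cbox (-a) a"
    using bounded_subset_cbox_symmetric[OF assms(3)] by blast
  show ?thesis
  proof (rule integrableI_bounded_set[where A = "cbox (-a) a" and B = K])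
    show "emeasure lborel (cbox (-a) a) < \<infinity>"
      using emeasure_lborel_cbox_finite[of "-a" a] by simp
  qed (use assms a in auto)
qed

text \<open>
  The codomain is arbitrary since the lemma serves both the real associativity law and the
  complex Fourier transform of a convolution.
\<close>

lemma fubini_bounded_support:
  fixes k :: "real \<Rightarrow> real \<Rightarrow> 'b::{banach, second_countable_topology}"
  assumes "case_prod k \<in> borel_measurable borel" "\<And>s t. norm (k s t) \<le> K"
    "\<And>s t. R < \<bar>s\<bar> \<or> R < \<bar>t\<bar> \<Longrightarrow> k s t = 0"
  shows "(LBINT s. LBINT t. k s t) = (LBINT t. LBINT s. k s t)"
proof -
  have "integrable lborel (case_prod k)"
  proof (rule integrable_bounded_support[where K = K and S = "{-R..R} \<times> {-R..R}"])
    show "bounded ({-R..R} \<times> {-R..R})"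
      by (intro bounded_Times bounded_closed_interval)
  next
    fix x :: "real \<times> real"
    assume "x \<notin> {-R..R} \<times> {-R..R}"
    then show "case_prod k x = 0"
      by (cases x) (auto intro!: assms(3))
  qed (use assms in auto)
  then have "integrable (lborel \<Otimes>\<^sub>M lborel) (case_prod k)"
    by (simp add: lborel_prod)
  then show ?thesis
    by (rule lborel_pair.Fubini_integral[symmetric])
qed

lemma bcs_integrable:
  assumes "bcs f"
  shows "integrable lborel f"
proof -
  obtain K R where "0 \<le> K" "0 \<le> R" and K: "\<And>x. \<bar>f x\<bar> \<le> K"
    and R: "\<And>x. R < \<bar>x\<bar> \<Longrightarrow> f x = 0"
    using bcsE[OF assms] by blast
  show "integrable lborel f"
    by (rule integrable_bounded_support[where K = K and S = "{-R..R}"])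
      (use bcs_measurable[OF assms] K R in auto)
qed

lemma bcs_mult_locally_bounded:
  assumes "bcs f" "h \<in> borel_measurable borel" "\<And>r. \<exists>K. \<forall>x. \<bar>x\<bar> \<le> r \<longrightarrow> \<bar>h x\<bar> \<le> K"
  shows "bcs (\<lambda>x. h x * f x)"
proof -
  obtain K R where K: "0 \<le> K" "0 \<le> R" "\<And>x. \<bar>f x\<bar> \<le> K" "\<And>x. R < \<bar>x\<bar> \<Longrightarrow> f x = 0"
    using bcsE[OF assms(1)] by blast
  obtain L where L: "\<And>x. \<bar>x\<bar> \<le> R \<Longrightarrow> \<bar>h x\<bar> \<le> L"
    using assms(3) by blast
  have L0: "0 \<le> L" using L[of 0] K(2) by auto
  show ?thesis
  proof (rule bcsI[where K = "L * K" and R = R])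
    show "\<bar>h x * f x\<bar> \<le> L * K" for x
    proof (cases "\<bar>x\<bar> \<le> R")
      case True
      then show ?thesis using K L L0 by (simp add: abs_mult mult_mono)
    next
      case False
      then show ?thesis using K L0 by simp
    qed
    show "(\<lambda>x. h x * f x) \<in> borel_measurable borel"
      by (intro borel_measurable_times assms(2) bcs_measurable[OF assms(1)])
  qed (use K in auto)
qed

lemma bcs_times_ident: "bcs f \<Longrightarrow> bcs (\<lambda>x. x * f x)"
  by (rule bcs_mult_locally_bounded) auto

lemma bcs_mult:
  assumes "bcs f" "bcs g"
  shows "bcs (\<lambda>x. f x * g x)"
  by (rule bcs_mult_locally_bounded[OF assms(2)])
    (use assms(1) in \<open>auto simp: bcs_def\<close>)

lemma bcs_affine:
  assumes "bcs f" "\<bar>c\<bar> = 1"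
  shows "bcs (\<lambda>x. f (a + c * x))"
proof -
  obtain K R where K: "0 \<le> K" "0 \<le> R" "\<And>x. \<bar>f x\<bar> \<le> K" "\<And>x. R < \<bar>x\<bar> \<Longrightarrow> f x = 0"
    using bcsE[OF assms(1)] by blast
  have [measurable]: "f \<in> borel_measurable borel" using assms bcs_measurable by blast
  have c: "c = 1 \<or> c = -1" using assms(2) by linarith
  show ?thesis
  proof (rule bcsI[where K = K and R = "R + \<bar>a\<bar>"])
    show "f (a + c * x) = 0" if "R + \<bar>a\<bar> < \<bar>x\<bar>" for x
      using c that by (intro K(4)) auto
  qed (use K in auto)
qed

lemma bcs_reflect: "bcs f \<Longrightarrow> bcs (\<lambda>x. f (a - x))"
  using bcs_affine[of f "-1" a] by simp

lemma bcs_shift: "bcs f \<Longrightarrow> bcs (\<lambda>x. f (x + a))"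
  using bcs_affine[of f 1 a] by (simp add: add.commute)

lemma bcs_diff: "bcs f \<Longrightarrow> bcs g \<Longrightarrow> bcs (\<lambda>x. f x - g x)"
proof -
  assume fg: "bcs f" "bcs g"
  obtain K R where "0 \<le> K" "0 \<le> R" and K: "\<And>x. \<bar>f x\<bar> \<le> K" "\<And>x. R < \<bar>x\<bar> \<Longrightarrow> f x = 0"
    using bcsE[OF fg(1)] by blast
  obtain L S where "0 \<le> L" "0 \<le> S" and L: "\<And>x. \<bar>g x\<bar> \<le> L" "\<And>x. S < \<bar>x\<bar> \<Longrightarrow> g x = 0"
    using bcsE[OF fg(2)] by blast
  show ?thesis
  proof (rule bcsI[where K = "K + L" and R = "max R S"])
    show "\<bar>f x - g x\<bar> \<le> K + L" for x
      using K(1)[of x] L(1)[of x] by linarith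
    show "(\<lambda>x. f x - g x) \<in> borel_measurable borel"
      using fg by (intro borel_measurable_diff bcs_measurable)
  qed (use K L in auto)
qed

lemma bcs_conv_integrand: "bcs f \<Longrightarrow> bcs g \<Longrightarrow> bcs (\<lambda>t. f t * g (x - t))"
  by (intro bcs_mult bcs_reflect)

lemma bcs_conv:
  assumes "bcs f" "bcs g"
  shows "bcs (conv f g)"
proof -
  obtain K R where K: "0 \<le> K" "0 \<le> R" "\<And>x. \<bar>f x\<bar> \<le> K" "\<And>x. R < \<bar>x\<bar> \<Longrightarrow> f x = 0"
    using bcsE[OF assms(1)] by blast
  obtain L S where L: "0 \<le> L" "0 \<le> S" "\<And>x. \<bar>g x\<bar> \<le> L" "\<And>x. S < \<bar>x\<bar> \<Longrightarrow> g x = 0"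
    using bcsE[OF assms(2)] by blast
  have [measurable]: "f \<in> borel_measurable borel" "g \<in> borel_measurable borel"
    using assms bcs_measurable by blast+
  show ?thesis
  proof (rule bcsI[where K = "2 * R * (K * L)" and R = "R + S"])
    show "conv f g \<in> borel_measurable borel"
      unfolding conv_def by measurable
  next
    fix x
    have "\<bar>conv f g x\<bar> \<le> (LBINT t. \<bar>f t * g (x - t)\<bar>)"
      unfolding conv_def by simp
    also have "\<dots> \<le> (LBINT t. indicator {-R..R} t * (K * L))"
    proof (rule integral_mono)
      show "integrable lborel (\<lambda>t. \<bar>f t * g (x - t)\<bar>)"
        using bcs_integrable[OF bcs_conv_integrand[OF assms]] by (rule integrable_abs)
      show "\<bar>f t * g (x - t)\<bar> \<le> indicator {-R..R} t * (K * L)" for t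
      proof (cases "\<bar>t\<bar> \<le> R")
        case True
        then show ?thesis using K L by (auto simp: abs_mult indicator_def intro!: mult_mono)
      next
        case False
        then show ?thesis using K L by (auto simp: indicator_def)
      qed
      show "integrable lborel (\<lambda>t. indicator {-R..R} t * (K * L))"
        by (intro integrable_mult_left integrable_real_indicator) (auto simp: emeasure_lborel_Icc_eq)
    qed
    also have "\<dots> = 2 * R * (K * L)"
      using K by simp
    finally show "\<bar>conv f g x\<bar> \<le> 2 * R * (K * L)" .
  next
    fix x assume x: "R + S < \<bar>x\<bar>"
    have "f t * g (x - t) = 0" for t
    proof (cases "\<bar>t\<bar> \<le> R")
      case True
      then have "S < \<bar>x - t\<bar>" using x by linarith
      then show ?thesis using L by simp
    next
      case False
      then show ?thesis using K by simp
    qed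
    then show "conv f g x = 0"
      unfolding conv_def by (subst Bochner_Integration.integral_cong[OF refl, where g = "\<lambda>_. 0"]) auto
  qed
qed

lemma lborel_integral_reflect:
  fixes f :: "real \<Rightarrow> 'b::{banach, second_countable_topology}"
  shows "(LBINT t. f (x - t)) = (LBINT t. f t)"
  using lborel_integral_real_affine[of "-1" f x] by simp

lemma lborel_integral_shift:
  fixes f :: "real \<Rightarrow> 'b::{banach, second_countable_topology}"
  shows "(LBINT t. f (t + x)) = (LBINT t. f t)"
  using lborel_integral_real_affine[of "1" f x] by (simp add: add.commute)

lemma conv_commute: "conv f g = conv g f"
proof
  fix x
  show "conv f g x = conv g f x"
    unfolding conv_def using lborel_integral_reflect[of "\<lambda>t. f t * g (x - t)" x]
    by (simp add: mult.commute)
qed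

lemma conv_assoc:
  assumes "bcs f" "bcs g" "bcs h"
  shows "conv (conv f g) h = conv f (conv g h)"
proof
  fix x
  obtain K R where K: "0 \<le> K" "0 \<le> R" "\<And>x. \<bar>f x\<bar> \<le> K" "\<And>x. R < \<bar>x\<bar> \<Longrightarrow> f x = 0"
    using bcsE[OF assms(1)] by blast
  obtain L S where L: "0 \<le> L" "0 \<le> S" "\<And>x. \<bar>g x\<bar> \<le> L" "\<And>x. S < \<bar>x\<bar> \<Longrightarrow> g x = 0"
    using bcsE[OF assms(2)] by blast
  obtain M T where M: "0 \<le> M" "0 \<le> T" "\<And>x. \<bar>h x\<bar> \<le> M" "\<And>x. T < \<bar>x\<bar> \<Longrightarrow> h x = 0"
    using bcsE[OF assms(3)] by blast
  have [measurable]: "f \<in> borel_measurable borel" "g \<in> borel_measurable borel" "h \<in> borel_measurable borel"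
    using assms bcs_measurable by blast+
  have "conv (conv f g) h x = (LBINT t. LBINT s. f s * g (t - s) * h (x - t))"
    by (simp add: conv_def)
  also have "\<dots> = (LBINT s. LBINT t. f s * g (t - s) * h (x - t))"
  proof (rule fubini_bounded_support[where K = "K * L * M" and R = "R + S"])
    show "(\<lambda>(t, s). f s * g (t - s) * h (x - t)) \<in> borel_measurable borel"
      unfolding borel_prod[symmetric] by measurable
    show "norm (f s * g (t - s) * h (x - t)) \<le> K * L * M" for s t
      using K L M by (auto simp: abs_mult intro!: mult_mono)
    show "f s * g (t - s) * h (x - t) = 0" if "R + S < \<bar>t\<bar> \<or> R + S < \<bar>s\<bar>" for s t
    proof (cases "R < \<bar>s\<bar>")
      case True
      then show ?thesis using K by simp
    next
      case False
      then have "S < \<bar>t - s\<bar>" using that K(2) L(2) by linarith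
      then show ?thesis using L by simp
    qed
  qed
  also have "\<dots> = (LBINT s. f s * conv g h (x - s))"
  proof (rule Bochner_Integration.integral_cong[OF refl])
    fix s
    have "(LBINT t. f s * g (t - s) * h (x - t)) = (LBINT t. f s * g (t + s - s) * h (x - (t + s)))"
      by (rule lborel_integral_shift[symmetric])
    also have "\<dots> = f s * conv g h (x - s)"
      by (simp add: conv_def algebra_simps flip: Bochner_Integration.integral_mult_right_zero)
    finally show "(LBINT t. f s * g (t - s) * h (x - t)) = f s * conv g h (x - s)" .
  qed
  also have "\<dots> = conv f (conv g h) x"
    by (simp add: conv_def)
  finally show "conv (conv f g) h x = conv f (conv g h) x" .
qed

lemma conv_scale_left: "conv (\<lambda>t. c * f t) g = (\<lambda>x. c * conv f g x)"
  by (auto simp: conv_def mult.assoc fun_eq_iff)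

text \<open>
  Multiplication by the variable is a derivation of the convolution algebra, because
  \<open>x = t + (x - t)\<close>.
\<close>

lemma ident_times_conv:
  assumes "bcs f" "bcs g"
  shows "(\<lambda>x. x * conv f g x) = (\<lambda>x. conv (\<lambda>t. t * f t) g x + conv f (\<lambda>t. t * g t) x)"
proof
  fix x
  have "conv (\<lambda>t. t * f t) g x + conv f (\<lambda>t. t * g t) x
      = (LBINT t. t * f t * g (x - t) + f t * ((x - t) * g (x - t)))"
    unfolding conv_def
    by (rule Bochner_Integration.integral_add[symmetric])
      (intro bcs_integrable bcs_conv_integrand[where g = g] bcs_conv_integrand[where g = "\<lambda>t. t * g t"]
        bcs_times_ident assms)+
  also have "\<dots> = (LBINT t. x * (f t * g (x - t)))"
    by (intro Bochner_Integration.integral_cong refl) (simp add: algebra_simps)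
  also have "\<dots> = x * conv f g x"
    by (simp add: conv_def)
  finally show "x * conv f g x = conv (\<lambda>t. t * f t) g x + conv f (\<lambda>t. t * g t) x" ..
qed

section \<open>B-splines as convolution powers\<close>

lemma rect_one: "rect 1 = indicator {-1/2..1/2}"
  by (simp add: fun_eq_iff)

lemma conv_rect_one: "conv (rect 1) f x = (LBINT t:{x - 1/2..x + 1/2}. f t)"
proof -
  have "conv (rect 1) f x = conv f (rect 1) x"
    by (simp add: conv_commute)
  also have "\<dots> = (LBINT t. f t * indicator {-1/2..1/2} (x - t))"
    by (simp only: conv_def rect_one)
  also have "\<dots> = (LBINT t:{x - 1/2..x + 1/2}. f t)"
    unfolding set_lebesgue_integral_def
    by (intro Bochner_Integration.integral_cong refl) (auto simp: indicator_def)
  finally show ?thesis .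
qed

lemma rect_Suc:
  assumes "1 \<le> p"
  shows "rect (Suc p) = conv (rect 1) (rect p)"
proof -
  obtain q where "p = Suc q" using assms by (cases p) auto
  then show ?thesis by (simp add: fun_eq_iff conv_rect_one del: One_nat_def)
qed

lemma rect_zero: "rect 0 = (\<lambda>x. 0)"
  by (simp add: fun_eq_iff)

declare rect.simps [simp del]

lemma bcs_rect_one: "bcs (rect 1)"
  unfolding rect_one by (rule bcsI[where K = 1 and R = "1/2"]) (auto simp: indicator_def)

lemma bcs_rect: "bcs (rect p)"
proof (cases "p = 0")
  case True
  then show ?thesis by (auto intro!: bcsI simp: rect_zero)
next
  case False
  then have "1 \<le> p" by simp
  then show ?thesis
    by (induction p rule: dec_induct) (auto simp: rect_Suc bcs_rect_one bcs_conv simp del: One_nat_def)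
qed

text \<open>
  \<open>rect p\<close> is the \<open>p\<close>-th convolution power of \<open>rect 1\<close>, so it obeys the power law.
\<close>

lemma conv_rect_rect:
  assumes "1 \<le> p" "1 \<le> q"
  shows "conv (rect p) (rect q) = rect (p + q)"
  using assms(1)
proof (induction p rule: dec_induct)
  case base
  show ?case using rect_Suc[OF assms(2)] by simp
next
  case (step p)
  then show ?case
    using assms by (simp add: rect_Suc conv_assoc bcs_rect del: One_nat_def)
qed

lemma rect_minus: "rect p (- x) = rect p x"
proof (cases "p = 0")
  case False
  then have "1 \<le> p" by simp
  then show ?thesis
  proof (induction p arbitrary: x rule: dec_induct)
    case base
    show ?case by (auto simp: rect_one indicator_def simp del: One_nat_def)
  next
    case (step p)
    have "rect (Suc p) (- x) = (LBINT t. rect 1 t * rect p (- x - t))"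
      using step by (simp add: rect_Suc conv_def del: One_nat_def)
    also have "\<dots> = (LBINT t. rect 1 (0 - t) * rect p (- x - (0 - t)))"
      by (rule lborel_integral_reflect[symmetric])
    also have "\<dots> = (LBINT t. rect 1 t * rect p (x - t))"
    proof (intro Bochner_Integration.integral_cong refl)
      fix t
      have "rect p (- x - (0 - t)) = rect p (x - t)"
        using step.IH[of "x - t"] by simp
      moreover have "rect 1 (0 - t) = rect 1 t"
        by (auto simp: rect_one indicator_def simp del: One_nat_def)
      ultimately show "rect 1 (0 - t) * rect p (- x - (0 - t)) = rect 1 t * rect p (x - t)"
        by simp
    qed
    also have "\<dots> = rect (Suc p) x"
      using step by (simp add: rect_Suc conv_def del: One_nat_def)
    finally show ?case .
  qed
qed (simp add: rect_zero)

lemma rect_nonneg: "0 \<le> rect p x"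
proof (cases "p = 0")
  case False
  then have "1 \<le> p" by simp
  then show ?thesis
    by (induction p arbitrary: x rule: dec_induct)
      (auto simp: rect_Suc conv_def rect_one simp del: One_nat_def intro!: integral_nonneg_AE)
qed (simp add: rect_zero)

lemma rect_eq_0:
  assumes "real p / 2 < \<bar>x\<bar>"
  shows "rect p x = 0"
proof (cases "p = 0")
  case False
  then have "1 \<le> p" by simp
  then show ?thesis
    using assms
  proof (induction p arbitrary: x rule: dec_induct)
    case base
    then show ?case by (auto simp: rect_one indicator_def simp del: One_nat_def)
  next
    case (step p)
    have "rect 1 t * rect p (x - t) = 0" for t
    proof (cases "\<bar>t\<bar> \<le> 1/2")
      case True
      moreover have "real p / 2 + 1 / 2 < \<bar>x\<bar>" using step.prems by (simp add: field_simps)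
      ultimately have "real p / 2 < \<bar>x - t\<bar>" by linarith
      then show ?thesis using step.IH by simp
    next
      case False
      then show ?thesis by (auto simp: rect_one indicator_def simp del: One_nat_def)
    qed
    then have "(\<lambda>t. rect 1 t * rect p (x - t)) = (\<lambda>t. 0)" by blast
    then show ?case
      using step.hyps by (simp add: rect_Suc conv_def del: One_nat_def)
  qed
qed (simp add: rect_zero)

section \<open>Second moments\<close>

text \<open>
  The first and second moment densities of \<open>rect 1\<close>.
\<close>

definition rect_x :: "real \<Rightarrow> real" where
  "rect_x t = t * rect 1 t"

definition rect_xx :: "real \<Rightarrow> real" where
  "rect_xx t = t * rect_x t"

lemma bcs_rect_x: "bcs rect_x"
  unfolding rect_x_def[abs_def] by (intro bcs_times_ident bcs_rect)

lemma conv_left_commute: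
  assumes "bcs f" "bcs g" "bcs h"
  shows "conv f (conv g h) = conv g (conv f h)"
  using conv_assoc[OF assms] conv_assoc[OF assms(2,1,3)] by (simp add: conv_commute[of f g])

lemma conv_scale_right: "conv f (\<lambda>t. c * g t) = (\<lambda>x. c * conv f g x)"
  using conv_scale_left[of c g f] by (simp add: conv_commute[of f])

text \<open>
  The Leibniz rule for the derivation \<open>f \<mapsto> x f\<close>, applied to a convolution power.
\<close>

lemma ident_times_rect:
  assumes "1 \<le> p"
  shows "(\<lambda>x. x * rect (Suc p) x) = (\<lambda>x. real (Suc p) * conv rect_x (rect p) x)"
  using assms
proof (induction p rule: dec_induct)
  case base
  have "(\<lambda>x. x * rect (Suc 1) x) = (\<lambda>x. conv rect_x (rect 1) x + conv (rect 1) rect_x x)"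
    using ident_times_conv[OF bcs_rect_one bcs_rect_one] rect_Suc[of 1]
    by (simp add: rect_x_def[abs_def] del: One_nat_def)
  then show ?case
    by (simp add: conv_commute[of "rect 1" rect_x] del: One_nat_def)
next
  case (step p)
  have "(\<lambda>x. x * rect (Suc (Suc p)) x) = (\<lambda>x. x * conv (rect 1) (rect (Suc p)) x)"
    by (simp add: rect_Suc[of "Suc p"] del: One_nat_def)
  also have "\<dots> = (\<lambda>x. conv rect_x (rect (Suc p)) x + conv (rect 1) (\<lambda>t. t * rect (Suc p) t) x)"
    using ident_times_conv[OF bcs_rect_one bcs_rect] by (simp add: rect_x_def[abs_def] del: One_nat_def)
  also have "conv (rect 1) (\<lambda>t. t * rect (Suc p) t) = (\<lambda>x. real (Suc p) * conv (rect 1) (conv rect_x (rect p)) x)"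
    unfolding step.IH conv_scale_right ..
  also have "conv (rect 1) (conv rect_x (rect p)) = conv rect_x (rect (Suc p))"
    using step.hyps by (simp add: conv_left_commute[of "rect 1"] bcs_rect bcs_rect_x rect_Suc del: One_nat_def)
  finally show ?case
    by (simp add: algebra_simps del: One_nat_def)
qed

lemma integral_rect_sq:
  assumes "1 \<le> p"
  shows "(LBINT x. (rect p x)\<^sup>2) = rect (2 * p) 0"
proof -
  have "rect (2 * p) 0 = conv (rect p) (rect p) 0"
    using conv_rect_rect[OF assms assms] by (simp add: mult_2)
  then show ?thesis by (simp add: conv_def rect_minus power2_eq_square)
qed

text \<open>
  Writing \<open>M f = x f\<close> and \<open>*\<close> for convolution, the left side is
  \<open>- ((M (rect p)) * (M (rect p))) 0\<close> for \<open>p = k + 1\<close>, as \<open>rect p\<close> is even. By the Leibniz rule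
  it is a multiple of \<open>(rect_x * rect_x * rect (2 k)) 0\<close>, which is computed from the fact that
  \<open>M (M (rect (2 p)))\<close> vanishes at \<open>0\<close>. In probabilistic terms: if \<open>2 p\<close> independent uniform variables
  are conditioned to have sum \<open>0\<close>, exchangeability expresses the variance of the sum of the first
  \<open>p\<close> by the variance of a single one.
\<close>

lemma integral_sq_times_rect_sq:
  assumes "1 \<le> k"
  shows "(LBINT x. x\<^sup>2 * (rect (Suc k) x)\<^sup>2)
    = (real (Suc k))\<^sup>2 / (2 * real k + 1) * conv rect_xx (rect (2 * k + 1)) 0"
proof -
  define m where "m = (\<lambda>x. x * rect (Suc k) x)"
  have m: "m = (\<lambda>x. real (Suc k) * conv rect_x (rect k) x)"
    unfolding m_def by (rule ident_times_rect[OF assms])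
  have m_odd: "m (- x) = - m x" for x
    by (simp add: m_def rect_minus)
  have "conv (conv rect_x (rect k)) (conv rect_x (rect k)) = conv rect_x (conv rect_x (rect (2 * k)))"
  proof -
    have "conv (conv rect_x (rect k)) (conv rect_x (rect k))
        = conv rect_x (conv (rect k) (conv rect_x (rect k)))"
      by (intro conv_assoc bcs_conv bcs_rect bcs_rect_x)
    also have "conv (rect k) (conv rect_x (rect k)) = conv rect_x (conv (rect k) (rect k))"
      by (intro conv_left_commute bcs_rect bcs_rect_x)
    finally show ?thesis using conv_rect_rect[OF assms assms] by (simp add: mult_2)
  qed
  then have mm: "conv m m 0 = (real (Suc k))\<^sup>2 * conv rect_x (conv rect_x (rect (2 * k))) 0"
    by (simp add: m conv_scale_left conv_scale_right power2_eq_square)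
  \<comment> \<open>The Leibniz rule at the point \<open>0\<close>, where the factor \<open>x\<close> vanishes.\<close>
  have "0 * conv rect_x (rect (2 * k + 1)) 0
      = conv rect_xx (rect (2 * k + 1)) 0 + conv rect_x (\<lambda>t. t * rect (2 * k + 1) t) 0"
    using fun_cong[OF ident_times_conv[OF bcs_rect_x bcs_rect[of "2 * k + 1"]], of 0]
    by (simp only: rect_xx_def[abs_def])
  also have "(\<lambda>t. t * rect (2 * k + 1) t) = (\<lambda>x. (2 * real k + 1) * conv rect_x (rect (2 * k)) x)"
    using ident_times_rect[of "2 * k"] assms by (simp add: add.commute)
  finally have "conv rect_xx (rect (2 * k + 1)) 0
      = - (2 * real k + 1) * conv rect_x (conv rect_x (rect (2 * k))) 0"
    unfolding conv_scale_right by linarith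
  moreover have "(LBINT x. x\<^sup>2 * (rect (Suc k) x)\<^sup>2) = - conv m m 0"
  proof -
    have "conv m m 0 = (LBINT t. - (t\<^sup>2 * (rect (Suc k) t)\<^sup>2))"
      unfolding conv_def
      by (intro Bochner_Integration.integral_cong refl) (simp add: m_odd, simp add: m_def power2_eq_square)
    then show ?thesis by simp
  qed
  moreover have "2 * real k + 1 \<noteq> 0" by linarith
  ultimately show ?thesis
    unfolding mm by (simp only: minus_mult_left[symmetric] mult_minus_right times_divide_eq_left
        nonzero_mult_div_cancel_left) simp
qed

section \<open>Smoothness\<close>

lemma antiderivative_exists:
  fixes f :: "real \<Rightarrow> real"
  assumes "continuous_on UNIV f"
  obtains F where "\<And>x. (F has_real_derivative f x) (at x)"
proof -
  have "isCont f x" for x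
    using assms by (simp add: continuous_on_eq_continuous_at)
  then have "\<exists>F. \<forall>x::real. -\<infinity> < ereal x \<longrightarrow> ereal x < \<infinity> \<longrightarrow> (F has_vector_derivative f x) (at x)"
    by (intro einterval_antiderivative) auto
  then show thesis
    using that by (auto simp: has_real_derivative_iff_has_vector_derivative)
qed

lemma conv_rect_one_antiderivative:
  assumes "continuous_on UNIV f" "\<And>x. (F has_real_derivative f x) (at x)"
  shows "conv (rect 1) f x = F (x + 1/2) - F (x - 1/2)"
proof -
  have "(LBINT t. f t * indicator {x - 1/2..x + 1/2} t) = F (x + 1/2) - F (x - 1/2)"
    by (rule integral_FTC_Icc_real)
      (use assms in \<open>auto simp: continuous_on_eq_continuous_at\<close>)
  then show ?thesis
    by (simp add: conv_rect_one set_lebesgue_integral_def mult.commute del: One_nat_def)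
qed

lemma DERIV_conv_rect_one:
  assumes "continuous_on UNIV f"
  shows "(conv (rect 1) f has_real_derivative f (x + 1/2) - f (x - 1/2)) (at x)"
proof -
  obtain F where F: "\<And>x. (F has_real_derivative f x) (at x)"
    using antiderivative_exists[OF assms] by blast
  have "((\<lambda>x. F (x + 1/2) - F (x - 1/2)) has_real_derivative f (x + 1/2) - f (x - 1/2)) (at x)"
    by (rule derivative_eq_intros DERIV_chain2[OF F] refl | simp)+
  then show ?thesis
    by (subst ext[OF conv_rect_one_antiderivative[OF assms F]])
qed

lemma rect_two: "rect 2 x = max 0 (1 - \<bar>x\<bar>)"
proof -
  have "rect 2 x = (LBINT t:{x - 1/2..x + 1/2}. indicator {-1/2..1/2} t)"
    using rect_Suc[of 1] conv_rect_one[of "rect 1" x]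
    by (simp only: rect_one Suc_1 order_refl simp_thms)
  also have "\<dots> = (LBINT t. indicator {max (x - 1/2) (-1/2)..min (x + 1/2) (1/2)} t)"
    unfolding set_lebesgue_integral_def
    by (intro Bochner_Integration.integral_cong refl) (auto simp: indicator_def)
  also have "\<dots> = max 0 (1 - \<bar>x\<bar>)"
    by (auto simp: max_def min_def abs_if)
  finally show ?thesis .
qed

lemma continuous_on_rect:
  assumes "2 \<le> p"
  shows "continuous_on UNIV (rect p)"
  using assms
proof (induction p rule: dec_induct)
  case base
  show ?case unfolding rect_two[abs_def] by (intro continuous_intros)
next
  case (step p)
  then have "(rect (Suc p) has_real_derivative rect p (x + 1/2) - rect p (x - 1/2)) (at x)" for x
    using DERIV_conv_rect_one[OF step.IH, of x] by (simp add: rect_Suc del: One_nat_def)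
  then show ?case
    by (intro continuous_at_imp_continuous_on ballI DERIV_isCont) blast
qed

lemma DERIV_rect:
  assumes "2 \<le> p"
  shows "(rect (Suc p) has_real_derivative rect p (x + 1/2) - rect p (x - 1/2)) (at x)"
  using DERIV_conv_rect_one[OF continuous_on_rect[OF assms], of x] assms
  by (simp add: rect_Suc del: One_nat_def)

section \<open>The Fourier transform\<close>

text \<open>
  The Fourier transform of \<open>rect 1\<close>, except that it takes the value \<open>0\<close> instead of \<open>1\<close> at \<open>0\<close>.
\<close>

definition hsinc :: "real \<Rightarrow> real" where
  "hsinc \<omega> = sin (\<omega> / 2) / (\<omega> / 2)"

lemma fourier_conv:
  assumes "bcs f" "bcs g"
  shows "fourier (\<lambda>x. complex_of_real (conv f g x)) \<omega>
    = fourier (\<lambda>x. complex_of_real (f x)) \<omega> * fourier (\<lambda>x. complex_of_real (g x)) \<omega>"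
proof -
  obtain K R where K: "0 \<le> K" "0 \<le> R" "\<And>x. \<bar>f x\<bar> \<le> K" "\<And>x. R < \<bar>x\<bar> \<Longrightarrow> f x = 0"
    using bcsE[OF assms(1)] by blast
  obtain L S where L: "0 \<le> L" "0 \<le> S" "\<And>x. \<bar>g x\<bar> \<le> L" "\<And>x. S < \<bar>x\<bar> \<Longrightarrow> g x = 0"
    using bcsE[OF assms(2)] by blast
  have [measurable]: "f \<in> borel_measurable borel" "g \<in> borel_measurable borel"
    using assms bcs_measurable by blast+
  define E where "E x = exp (- \<i> * complex_of_real \<omega> * complex_of_real x)" for x
  have E_add: "E (x + y) = E x * E y" for x y
    by (simp add: E_def exp_add[symmetric] algebra_simps)
  have E_norm: "norm (E x) = 1" for x
    by (simp add: E_def norm_exp_eq_Re)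
  have [measurable]: "E \<in> borel_measurable borel"
    unfolding E_def by (intro borel_measurable_continuous_onI continuous_intros)
  have "fourier (\<lambda>x. complex_of_real (conv f g x)) \<omega>
      = (LBINT x. LBINT t. E x * complex_of_real (f t * g (x - t)))"
    unfolding fourier_def conv_def
    by (simp only: E_def integral_complex_of_real[symmetric] integral_mult_right_zero)
  also have "\<dots> = (LBINT t. LBINT x. E x * complex_of_real (f t * g (x - t)))"
  proof (rule fubini_bounded_support[where K = "K * L" and R = "R + S"])
    show "(\<lambda>(x, t). E x * complex_of_real (f t * g (x - t))) \<in> borel_measurable borel"
      unfolding borel_prod[symmetric] by measurable
    show "norm (E x * complex_of_real (f t * g (x - t))) \<le> K * L" for x t
      using K L by (auto simp: norm_mult abs_mult E_norm intro!: mult_mono)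
    show "E x * complex_of_real (f t * g (x - t)) = 0" if "R + S < \<bar>x\<bar> \<or> R + S < \<bar>t\<bar>" for x t
    proof (cases "R < \<bar>t\<bar>")
      case True
      then show ?thesis using K by simp
    next
      case False
      then have "S < \<bar>x - t\<bar>" using that K(2) L(2) by linarith
      then show ?thesis using L by simp
    qed
  qed
  also have "\<dots> = (LBINT t. (E t * complex_of_real (f t)) * fourier (\<lambda>x. complex_of_real (g x)) \<omega>)"
  proof (rule Bochner_Integration.integral_cong[OF refl])
    fix t
    have "(LBINT x. E x * complex_of_real (f t * g (x - t)))
        = (LBINT x. E (x + t) * complex_of_real (f t * g (x + t - t)))"
      by (rule lborel_integral_shift[symmetric])
    also have "\<dots> = (LBINT x. (E t * complex_of_real (f t)) * (E x * complex_of_real (g x)))"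
      by (simp add: E_add algebra_simps)
    also have "\<dots> = (E t * complex_of_real (f t)) * fourier (\<lambda>x. complex_of_real (g x)) \<omega>"
      by (simp only: integral_mult_right_zero fourier_def E_def)
    finally show "(LBINT x. E x * complex_of_real (f t * g (x - t)))
        = (E t * complex_of_real (f t)) * fourier (\<lambda>x. complex_of_real (g x)) \<omega>" .
  qed
  also have "\<dots> = fourier (\<lambda>x. complex_of_real (f x)) \<omega> * fourier (\<lambda>x. complex_of_real (g x)) \<omega>"
    by (simp only: integral_mult_left_zero fourier_def E_def)
  finally show ?thesis .
qed

lemma fourier_rect_one:
  assumes "\<omega> \<noteq> 0"
  shows "fourier (\<lambda>x. complex_of_real (rect 1 x)) \<omega> = complex_of_real (hsinc \<omega>)"
proof -
  define F where "F x = \<i> / complex_of_real \<omega> * exp (- \<i> * complex_of_real \<omega> * complex_of_real x)" for x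
  define E where "E x = exp (- \<i> * complex_of_real \<omega> * complex_of_real x)" for x
  have "fourier (\<lambda>x. complex_of_real (rect 1 x)) \<omega> = (LBINT x. indicator {-1/2..1/2} x *\<^sub>R E x)"
    unfolding fourier_def E_def rect_one
    by (intro Bochner_Integration.integral_cong refl) (auto simp: indicator_def)
  also have "\<dots> = F (1/2) - F (-1/2)"
  proof (rule integral_FTC_Icc)
    fix x :: real
    have "(F has_vector_derivative (\<i> / complex_of_real \<omega> * (- \<i> * complex_of_real \<omega> * E x))) (at x)"
      unfolding F_def[abs_def] E_def
      by (rule derivative_eq_intros has_vector_derivative_real_field refl | simp)+
    then show "(F has_vector_derivative E x) (at x within {-1/2..1/2})"
      using assms by (auto intro: has_vector_derivative_at_within)
    show "continuous_on {-1/2..1/2} E"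
      unfolding E_def by (intro continuous_intros)
  qed auto
  also have "\<dots> = \<i> / complex_of_real \<omega> * (cis (- (\<omega> / 2)) - cis (\<omega> / 2))"
    by (simp add: F_def cis_conv_exp algebra_simps)
  also have "\<dots> = complex_of_real (hsinc \<omega>)"
    using assms by (simp add: hsinc_def complex_eq_iff field_simps)
  finally show ?thesis .
qed

lemma fourier_rect:
  assumes "\<omega> \<noteq> 0" "1 \<le> p"
  shows "fourier (\<lambda>x. complex_of_real (rect p x)) \<omega> = complex_of_real (hsinc \<omega> ^ p)"
  using assms(2)
proof (induction p rule: dec_induct)
  case base
  then show ?case using fourier_rect_one[OF assms(1)] by simp
next
  case (step p)
  then show ?case
    using fourier_rect_one[OF assms(1)]
    by (simp add: rect_Suc fourier_conv bcs_rect del: One_nat_def)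
qed

lemma integral_rect:
  assumes "1 \<le> p"
  shows "(LBINT x. rect p x) = 1"
proof -
  have four: "fourier (\<lambda>x. complex_of_real (f x)) 0 = complex_of_real (LBINT x. f x)" for f
    by (simp add: fourier_def)
  have "fourier (\<lambda>x. complex_of_real (rect p x)) 0 = 1"
    using assms
  proof (induction p rule: dec_induct)
    case base
    then show ?case by (simp add: four rect_one del: One_nat_def)
  next
    case (step p)
    have "fourier (\<lambda>x. complex_of_real (rect 1 x)) 0 = 1"
      by (simp add: four rect_one del: One_nat_def)
    with step show ?case
      by (simp add: rect_Suc fourier_conv bcs_rect del: One_nat_def)
  qed
  then show ?thesis by (simp only: four of_real_eq_1_iff)
qed

lemma borel_measurable_hsinc [measurable]: "hsinc \<in> borel_measurable borel"
  unfolding hsinc_def[abs_def] by measurable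

lemma abs_hsinc_le: "\<bar>hsinc \<omega>\<bar> \<le> 1"
  using abs_sin_x_le_abs_x[of "\<omega> / 2"] by (cases "\<omega> = 0") (auto simp: hsinc_def field_simps)

lemma abs_hsinc_le': "\<bar>hsinc \<omega>\<bar> \<le> 2 / \<bar>\<omega>\<bar>"
proof -
  have "\<bar>hsinc \<omega>\<bar> = 2 * \<bar>sin (\<omega> / 2)\<bar> / \<bar>\<omega>\<bar>" by (simp add: hsinc_def abs_mult)
  also have "\<dots> \<le> 2 * 1 / \<bar>\<omega>\<bar>" by (intro divide_right_mono mult_left_mono) auto
  finally show ?thesis by simp
qed

lemma integrable_lborel_inverse_1_plus_square: "integrable lborel (\<lambda>x::real. inverse (1 + x\<^sup>2))"
  using integrable_inverse_1_plus_square by (simp add: set_integrable_def einterval_def)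

lemma integrable_hsinc_power:
  assumes "2 \<le> q"
  shows "integrable lborel (\<lambda>\<omega>. hsinc \<omega> ^ q)"
proof (rule Bochner_Integration.integrable_bound)
  show "integrable lborel (\<lambda>x::real. 5 * inverse (1 + x\<^sup>2))"
    by (intro integrable_mult_right integrable_lborel_inverse_1_plus_square)
  show "AE \<omega> in lborel. norm (hsinc \<omega> ^ q) \<le> norm (5 * inverse (1 + \<omega>\<^sup>2))"
  proof (intro AE_I2)
    fix \<omega> :: real
    have "norm (hsinc \<omega> ^ q) = \<bar>hsinc \<omega>\<bar> ^ q" by (simp add: power_abs)
    also have "\<dots> \<le> \<bar>hsinc \<omega>\<bar> ^ 2" by (rule power_decreasing) (use abs_hsinc_le assms in auto)
    also have "\<dots> \<le> 5 * inverse (1 + \<omega>\<^sup>2)"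
    proof -
      have 1: "\<bar>hsinc \<omega>\<bar> ^ 2 \<le> 1" using abs_hsinc_le[of \<omega>] by (simp add: abs_square_le_1)
      have "\<bar>hsinc \<omega>\<bar> ^ 2 * \<omega>\<^sup>2 \<le> 4"
      proof (cases "\<omega> = 0")
        case False
        have "\<bar>hsinc \<omega>\<bar> * \<bar>\<omega>\<bar> \<le> 2"
          using abs_hsinc_le'[of \<omega>] False by (simp add: field_simps)
        then have "(\<bar>hsinc \<omega>\<bar> * \<bar>\<omega>\<bar>)\<^sup>2 \<le> 2\<^sup>2" by (intro power_mono) auto
        then show ?thesis by (simp add: power_mult_distrib)
      qed simp
      with 1 have "\<bar>hsinc \<omega>\<bar> ^ 2 * (1 + \<omega>\<^sup>2) \<le> 5" by (simp only: distrib_left)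
      moreover have "0 < 1 + \<omega>\<^sup>2" by (simp add: add_pos_nonneg)
      ultimately show ?thesis by (simp add: field_simps)
    qed
    finally show "norm (hsinc \<omega> ^ q) \<le> norm (5 * inverse (1 + \<omega>\<^sup>2))" by simp
  qed
qed measurable

section \<open>Fourier inversion\<close>

lemma hsinc_minus: "hsinc (- \<omega>) = hsinc \<omega>"
  by (simp add: hsinc_def)

lemma real_distribution_rect:
  assumes "1 \<le> p"
  shows "real_distribution (density lborel (\<lambda>x. ennreal (rect p x)))"
proof -
  have [measurable]: "rect p \<in> borel_measurable borel"
    by (rule bcs_measurable[OF bcs_rect])
  have "prob_space (density lborel (\<lambda>x. ennreal (rect p x)))"
  proof (rule prob_spaceI)
    show "emeasure (density lborel (\<lambda>x. ennreal (rect p x))) (space (density lborel (\<lambda>x. ennreal (rect p x)))) = 1"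
      using integral_rect[OF assms] bcs_integrable[OF bcs_rect[of p]]
      by (simp add: emeasure_density nn_integral_eq_integral rect_nonneg)
  qed
  then show ?thesis
    by (simp add: real_distribution_def real_distribution_axioms_def)
qed

lemma char_rect:
  assumes "1 \<le> p" "t \<noteq> 0"
  shows "char (density lborel (\<lambda>x. ennreal (rect p x))) t = complex_of_real (hsinc t ^ p)"
proof -
  have [measurable]: "rect p \<in> borel_measurable borel"
    by (rule bcs_measurable[OF bcs_rect])
  have "char (density lborel (\<lambda>x. ennreal (rect p x))) t = (LBINT x. rect p x *\<^sub>R iexp (t * x))"
    unfolding char_def by (subst integral_density) (auto simp: rect_nonneg)
  also have "\<dots> = fourier (\<lambda>x. complex_of_real (rect p x)) (- t)"
    unfolding fourier_def
    by (intro Bochner_Integration.integral_cong refl) (simp add: scaleR_conv_of_real mult_ac)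
  also have "\<dots> = complex_of_real (hsinc t ^ p)"
    using fourier_rect[of "- t" p] assms by (simp add: hsinc_minus)
  finally show ?thesis .
qed

lemma measure_rect:
  assumes "1 \<le> p" "A \<in> sets borel"
  shows "measure (density lborel (\<lambda>x. ennreal (rect p x))) A = (LBINT x:A. rect p x)"
proof -
  have [measurable]: "rect p \<in> borel_measurable borel"
    by (rule bcs_measurable[OF bcs_rect])
  have i: "integrable lborel (\<lambda>x. rect p x * indicator A x)"
    using bcs_integrable[OF bcs_rect[of p]] assms(2) by (intro integrable_real_mult_indicator) auto
  have "emeasure (density lborel (\<lambda>x. ennreal (rect p x))) A
      = (\<integral>\<^sup>+x. ennreal (rect p x * indicator A x) \<partial>lborel)"
    using assms(2) by (auto simp: emeasure_density intro!: nn_integral_cong split: split_indicator)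
  also have "\<dots> = ennreal (LBINT x. rect p x * indicator A x)"
    by (intro nn_integral_eq_integral i) (auto simp: rect_nonneg)
  finally show ?thesis
    unfolding measure_def set_lebesgue_integral_def
    by (simp add: rect_nonneg mult.commute)
qed

text \<open>
  With \<open>q = p + 1\<close>, the value \<open>rect q x\<close> is the mass that the density \<open>rect p\<close> gives to an interval of
  length \<open>1\<close> around \<open>x\<close>. Levy's inversion formula expresses this mass by the characteristic
  function \<open>hsinc ^ p\<close>, and the interval contributes the missing factor \<open>hsinc\<close>. For \<open>q \<ge> 2\<close> the
  integrand is absolutely integrable, so the truncated integrals converge to the full one.
\<close>

lemma rect_inversion:
  assumes "2 \<le> q"
  shows "(LBINT \<omega>. cos (\<omega> * x) * hsinc \<omega> ^ q) = 2 * pi * rect q x"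
proof -
  obtain p where p: "q = Suc p" "1 \<le> p" using assms by (cases q) auto
  define M where "M = density lborel (\<lambda>x. ennreal (rect p x))"
  interpret real_distribution M
    unfolding M_def by (rule real_distribution_rect[OF p(2)])
  define G where "G t = iexp (- (t * x)) * complex_of_real (hsinc t ^ q)" for t
  have [measurable]: "G \<in> borel_measurable borel"
    unfolding G_def by measurable
  have intG: "integrable lborel G"
  proof (rule Bochner_Integration.integrable_bound)
    show "integrable lborel (\<lambda>t. hsinc t ^ q)" by (rule integrable_hsinc_power[OF assms])
  qed (auto simp: G_def norm_mult norm_power power_abs)
  have pt: "measure M {a} = 0" for a
  proof -
    have "measure M {a} = (LBINT x:{a}. rect p x)"
      unfolding M_def by (rule measure_rect[OF p(2)]) simp
    also have "\<dots> = (LBINT x:{}. rect p x)"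
      by (rule set_integral_discrete_difference[where X = "{a}"]) auto
    finally show ?thesis by (simp add: set_lebesgue_integral_def)
  qed
  have integrand: "(iexp (- (t * (x - 1/2))) - iexp (- (t * (x + 1/2)))) / (\<i> * t) * char M t = G t"
    if "t \<noteq> 0" for t
  proof -
    have "iexp (- (t * (x - 1/2))) - iexp (- (t * (x + 1/2)))
        = iexp (- (t * x)) * (cis (t / 2) - cis (- (t / 2)))"
      by (simp add: cis_conv_exp exp_add[symmetric] algebra_simps)
    also have "\<dots> = iexp (- (t * x)) * (2 * \<i> * sin (t / 2))"
      by (simp add: complex_eq_iff)
    finally have "(iexp (- (t * (x - 1/2))) - iexp (- (t * (x + 1/2)))) / (\<i> * t)
        = iexp (- (t * x)) * complex_of_real (hsinc t)"
      using that by (simp add: hsinc_def field_simps)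
    then show ?thesis
      using that p by (simp add: M_def char_rect G_def)
  qed
  have "(\<lambda>T::nat. 1 / (2 * pi) * (CLBINT t=-T..T.
      (iexp (- (t * (x - 1/2))) - iexp (- (t * (x + 1/2)))) / (\<i> * t) * char M t))
      \<longlonglongrightarrow> measure M {x - 1/2<..x + 1/2}"
    by (rule Levy_Inversion) (auto simp: pt)
  moreover have "(CLBINT t=-T..T.
      (iexp (- (t * (x - 1/2))) - iexp (- (t * (x + 1/2)))) / (\<i> * t) * char M t)
      = (LBINT t. indicator {-real T..real T} t *\<^sub>R G t)" for T :: nat
  proof -
    have "(CLBINT t=-T..T.
      (iexp (- (t * (x - 1/2))) - iexp (- (t * (x + 1/2)))) / (\<i> * t) * char M t) = (CLBINT t=-T..T. G t)"
    proof (rule interval_lebesgue_integral_cong_AE)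
      show "AE t\<in>einterval (- T) T in lborel.
          (iexp (- (t * (x - 1/2))) - iexp (- (t * (x + 1/2)))) / (\<i> * t) * char M t = G t"
        using AE_lborel_singleton[of "0::real"] by eventually_elim (intro impI integrand)
    qed auto
    also have "\<dots> = (CLBINT t:{-real T..real T}. G t)"
      by (simp add: interval_integral_Icc)
    finally show ?thesis unfolding set_lebesgue_integral_def .
  qed
  moreover have "(\<lambda>T::nat. LBINT t. indicator {-real T..real T} t *\<^sub>R G t) \<longlonglongrightarrow> (LBINT t. G t)"
  proof (rule integral_dominated_convergence[where w = "\<lambda>t. norm (G t)"])
    show "integrable lborel (\<lambda>t. norm (G t))" using intG by simp
    show "AE t in lborel. (\<lambda>T::nat. indicator {-real T..real T} t *\<^sub>R G t) \<longlonglongrightarrow> G t"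
    proof (intro AE_I2 tendsto_eventually)
      fix t :: real
      obtain N :: nat where "\<bar>t\<bar> \<le> real N" using real_arch_simple by blast
      then show "\<forall>\<^sub>F T::nat in sequentially. indicator {-real T..real T} t *\<^sub>R G t = G t"
        by (intro eventually_sequentiallyI[of N]) (auto simp: indicator_def)
    qed
  qed (auto split: split_indicator)
  ultimately have "(\<lambda>T::nat. 1 / (2 * pi) * (LBINT t. indicator {-real T..real T} t *\<^sub>R G t))
      \<longlonglongrightarrow> complex_of_real (measure M {x - 1/2<..x + 1/2})"
    and "(\<lambda>T::nat. 1 / (2 * pi) * (LBINT t. indicator {-real T..real T} t *\<^sub>R G t))
      \<longlonglongrightarrow> 1 / (2 * pi) * (LBINT t. G t)"
    by (auto intro!: tendsto_intros)
  then have eq: "1 / (2 * pi) * (LBINT t. G t) = complex_of_real (measure M {x - 1/2<..x + 1/2})"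
    by (rule LIMSEQ_unique[rotated])
  have "measure M {x - 1/2<..x + 1/2} = (LBINT t:{x - 1/2<..x + 1/2}. rect p t)"
    unfolding M_def by (rule measure_rect[OF p(2)]) simp
  also have "\<dots> = (LBINT t:{x - 1/2..x + 1/2}. rect p t)"
    by (rule set_integral_discrete_difference[where X = "{x - 1/2}"]) auto
  also have "\<dots> = rect q x"
    using p by (simp add: rect_Suc conv_rect_one del: One_nat_def)
  finally have "(LBINT t. G t) = complex_of_real (2 * pi * rect q x)"
    using eq by (simp add: field_simps)
  then have "Re (LBINT t. G t) = 2 * pi * rect q x" by simp
  moreover have "Re (LBINT t. G t) = (LBINT t. cos (t * x) * hsinc t ^ q)"
    unfolding integral_Re[OF intG, symmetric]
    by (intro Bochner_Integration.integral_cong refl) (simp add: G_def Re_exp)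
  ultimately show ?thesis by simp
qed

lemma hsinc_nu_denominator:
  assumes "1 \<le> p"
  shows "(LBINT \<omega>. hsinc \<omega> ^ (2 * p)) = 2 * pi * rect (2 * p) 0"
  using rect_inversion[of "2 * p" 0] assms by simp

text \<open>
  The factor \<open>\<omega>\<^sup>2\<close> turns two factors \<open>hsinc \<omega>\<close> into \<open>2 - 2 * cos \<omega>\<close>.
\<close>

lemma hsinc_nu_numerator:
  assumes "2 \<le> p"
  shows "(LBINT \<omega>. \<omega>\<^sup>2 * hsinc \<omega> ^ (2 * p)) = 4 * pi * (rect (2 * p - 2) 0 - rect (2 * p - 2) 1)"
proof -
  define q where "q = 2 * p - 2"
  have q: "2 \<le> q" "2 * p = q + 2" using assms by (auto simp: q_def)
  have eq: "\<omega>\<^sup>2 * hsinc \<omega> ^ (2 * p) = 2 * hsinc \<omega> ^ q - 2 * (cos (\<omega> * 1) * hsinc \<omega> ^ q)" for \<omega>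
  proof (cases "\<omega> = 0")
    case True
    then show ?thesis using q by (simp add: hsinc_def)
  next
    case False
    have "\<omega>\<^sup>2 * hsinc \<omega> ^ (2 * p) = (\<omega>\<^sup>2 * (hsinc \<omega>)\<^sup>2) * hsinc \<omega> ^ q"
      unfolding q(2) by (simp add: power_add power2_eq_square)
    also have "\<omega>\<^sup>2 * (hsinc \<omega>)\<^sup>2 = 4 * (sin (\<omega> / 2))\<^sup>2"
      using False by (simp add: hsinc_def field_simps)
    also have "\<dots> = 2 - 2 * cos \<omega>"
      using cos_double_sin[of "\<omega> / 2"] by simp
    finally show ?thesis by (simp add: algebra_simps)
  qed
  have i: "integrable lborel (\<lambda>\<omega>. hsinc \<omega> ^ q)" by (rule integrable_hsinc_power[OF q(1)])
  have "integrable lborel (\<lambda>\<omega>. cos (\<omega> * 1) * hsinc \<omega> ^ q)"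
    by (rule Bochner_Integration.integrable_bound[OF i])
      (auto simp: abs_mult power_abs intro!: mult_left_le_one_le)
  with i show "(LBINT \<omega>. \<omega>\<^sup>2 * hsinc \<omega> ^ (2 * p)) = 4 * pi * (rect (2 * p - 2) 0 - rect (2 * p - 2) 1)"
    using rect_inversion[OF q(1), of 0] rect_inversion[OF q(1), of 1]
    unfolding eq q_def[symmetric] by (simp add: right_diff_distrib)
qed

section \<open>Monotonicity of the ratio of slope and abscissa\<close>

text \<open>
  On the positive half-line \<open>H x / x\<close> is nonincreasing; stated without division.
\<close>

definition ratio_antimono :: "(real \<Rightarrow> real) \<Rightarrow> bool" where
  "ratio_antimono H \<longleftrightarrow> (\<forall>x y. 0 < x \<longrightarrow> x \<le> y \<longrightarrow> x * H y \<le> y * H x)"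

text \<open>
  Two convolutions with \<open>rect 1\<close> preserve the property for odd functions. (If \<open>H\<close> is the negative
  derivative of a marginal density of a rotationally symmetric density in dimension three, then
  \<open>H x / x\<close> is proportional to the latter, and \<open>rect 2\<close> is the marginal of such a density
  proportional to \<open>1 / r\<close> on the unit ball; the lemma says that unimodality survives the convolution.)

  For the proof let \<open>V\<close> be the convolution and \<open>E x = V x - x V' x\<close>, which must be nonnegative. Its
  derivative is \<open>x (2 H x - H (x + 1) - H (x - 1))\<close>, which is nonnegative on \<open>[0, 1]\<close>. For \<open>x \<ge> 1\<close>
  one has instead that \<open>E x\<close> is the integral of \<open>z H (z - 1) - (z - 1) H z\<close> over \<open>[x, x + 1]\<close>.
\<close>

lemma ratio_antimono_conv:
  assumes cont: "continuous_on UNIV H" and odd: "\<And>x. H (- x) = - H x" and H: "ratio_antimono H"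
    and zero: "conv (rect 1) (conv (rect 1) H) 0 = 0"
  shows "ratio_antimono (conv (rect 1) (conv (rect 1) H))"
proof -
  define V where "V = conv (rect 1) (conv (rect 1) H)"
  obtain P where P: "\<And>x. (P has_real_derivative H x) (at x)"
    using antiderivative_exists[OF cont] by blast
  then have "continuous_on UNIV P"
    by (meson DERIV_isCont continuous_at_imp_continuous_on)
  then obtain Q where Q: "\<And>x. (Q has_real_derivative P x) (at x)"
    using antiderivative_exists by blast
  have PH: "conv (rect 1) H = (\<lambda>x. P (x + 1/2) - P (x - 1/2))"
    by (intro ext conv_rect_one_antiderivative[OF cont P])
  have V: "V x = Q (x + 1) - 2 * Q x + Q (x - 1)" for x
  proof -
    have "V x = (Q (x + 1/2 + 1/2) - Q (x + 1/2 - 1/2)) - (Q (x - 1/2 + 1/2) - Q (x - 1/2 - 1/2))"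
      unfolding V_def PH
    proof (rule conv_rect_one_antiderivative)
      show "continuous_on UNIV (\<lambda>x. P (x + 1/2) - P (x - 1/2))"
        by (intro continuous_on_diff continuous_on_compose2[OF \<open>continuous_on UNIV P\<close>] continuous_intros) auto
      show "((\<lambda>x. (Q (x + 1/2) - Q (x - 1/2))) has_real_derivative P (x + 1/2) - P (x - 1/2)) (at x)" for x
        by (rule derivative_eq_intros DERIV_chain2[OF Q] refl | simp)+
    qed
    then show ?thesis by (simp add: add.commute)
  qed
  define D where "D x = P (x + 1) - 2 * P x + P (x - 1)" for x
  have DV: "(V has_real_derivative D x) (at x)" for x
    unfolding V D_def[abs_def] ext[OF V]
    by (rule derivative_eq_intros DERIV_chain2[OF Q] refl | simp)+
  have DD: "(D has_real_derivative H (x + 1) - 2 * H x + H (x - 1)) (at x)" for x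
    unfolding D_def[abs_def]
    by (rule derivative_eq_intros DERIV_chain2[OF P] refl | simp)+
  define E where "E x = V x - x * D x" for x
  have DE: "(E has_real_derivative x * (2 * H x - H (x + 1) - H (x - 1))) (at x)" for x
    unfolding E_def[abs_def]
    by (rule derivative_eq_intros DV DD refl | simp add: algebra_simps)+
  have H0: "H 0 = 0" using odd[of 0] by simp
  have H_ratio: "x * H y \<le> y * H x" if "0 < x" "x \<le> y" for x y
    using H that by (auto simp: ratio_antimono_def)
  have E_small: "0 \<le> E x" if "0 \<le> x" "x \<le> 1" for x
  proof -
    have "E 0 \<le> E x"
    proof (rule DERIV_nonneg_imp_nondecreasing[OF that(1)])
      fix z assume z: "0 \<le> z" "z \<le> x"
      have "0 \<le> z * (2 * H z - H (z + 1) - H (z - 1))"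
      proof -
        consider "z = 0" | "z = 1" | "0 < z" "z < 1" using z \<open>x \<le> 1\<close> by linarith
        then show ?thesis
        proof cases
          case 2
          then show ?thesis using H_ratio[of 1 2] H0 by simp
        next
          case 3
          have "(1 + z) * (2 * H z + H (1 - z) - H (1 + z)) \<ge> 0"
            using H_ratio[of z "1 + z"] H_ratio[of "1 - z" "1 + z"] 3 by (simp add: algebra_simps)
          then have "0 \<le> 2 * H z + H (1 - z) - H (1 + z)"
            using 3 by (simp add: zero_le_mult_iff)
          moreover have "H (z - 1) = - H (1 - z)" using odd[of "1 - z"] by simp
          ultimately show ?thesis using 3 by (simp add: add.commute)
        qed simp
      qed
      then show "\<exists>y. (E has_real_derivative y) (at z) \<and> 0 \<le> y"
        using DE by blast
    qed
    moreover have "E 0 = 0" using zero by (simp add: E_def V_def)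
    ultimately show ?thesis by simp
  qed
  have E_large: "0 \<le> E x" if "1 \<le> x" for x
  proof -
    \<comment> \<open>\<open>S\<close> is an antiderivative of the integrand, so \<open>S (x + 1) - S x = E x\<close>.\<close>
    define S where "S z = z * P (z - 1) - Q (z - 1) - ((z - 1) * P z - Q z)" for z
    have "S x \<le> S (x + 1)"
    proof (rule DERIV_nonneg_imp_nondecreasing[where f = S])
      fix z assume z: "x \<le> z" "z \<le> x + 1"
      have "(S has_real_derivative z * H (z - 1) - (z - 1) * H z) (at z)"
        unfolding S_def[abs_def]
        by (rule derivative_eq_intros DERIV_chain2[OF P] DERIV_chain2[OF Q] refl | simp add: algebra_simps)+
      moreover have "0 \<le> z * H (z - 1) - (z - 1) * H z"
        using H_ratio[of "z - 1" z] z that H0 by (cases "z = 1") auto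
      ultimately show "\<exists>y. (S has_real_derivative y) (at z) \<and> 0 \<le> y" by blast
    qed simp
    moreover have "S (x + 1) - S x = E x"
      by (simp add: S_def E_def V D_def algebra_simps)
    ultimately show ?thesis by simp
  qed
  have E: "0 \<le> E x" if "0 \<le> x" for x
    using E_small E_large that by (cases "x \<le> 1") auto
  show ?thesis
    unfolding ratio_antimono_def V_def[symmetric]
  proof (intro allI impI)
    fix x y :: real assume xy: "0 < x" "x \<le> y"
    have "V y / y \<le> V x / x"
    proof (rule DERIV_nonpos_imp_nonincreasing[OF xy(2)])
      fix z assume z: "x \<le> z" "z \<le> y"
      have "((\<lambda>z. V z / z) has_real_derivative - (E z / (z * z))) (at z)"
        unfolding E_def using xy z
        by (auto intro!: derivative_eq_intros DV simp: algebra_simps simp flip: minus_divide_left)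
          (simp add: diff_divide_distrib)
      moreover have "- (E z / (z * z)) \<le> 0" using E[of z] xy z by simp
      ultimately show "\<exists>d. ((\<lambda>z. V z / z) has_real_derivative d) (at z) \<and> d \<le> 0" by blast
    qed
    then show "x * V y \<le> y * V x" using xy by (simp add: field_simps)
  qed
qed

text \<open>
  The negative derivative of \<open>rect (n + 1)\<close>, for \<open>n \<ge> 2\<close>.
\<close>

definition slope :: "nat \<Rightarrow> real \<Rightarrow> real" where
  "slope n x = rect n (x - 1/2) - rect n (x + 1/2)"

lemma bcs_slope: "bcs (slope n)"
  unfolding slope_def[abs_def]
  using bcs_diff[OF bcs_shift[OF bcs_rect[of n], of "-1/2"] bcs_shift[OF bcs_rect[of n], of "1/2"]]
  by simp

lemma slope_minus: "slope n (- x) = - slope n x"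
  using rect_minus[of n "x + 1/2"] rect_minus[of n "x - 1/2"] by (simp add: slope_def)

lemma conv_rect_one_slope:
  assumes "1 \<le> n"
  shows "conv (rect 1) (slope n) = slope (Suc n)"
proof
  fix x
  have "conv (rect 1) (slope n) x
      = (LBINT t. rect 1 t * rect n (x - 1/2 - t) - rect 1 t * rect n (x + 1/2 - t))"
    unfolding conv_def
    by (intro Bochner_Integration.integral_cong refl) (simp add: slope_def algebra_simps)
  also have "\<dots> = conv (rect 1) (rect n) (x - 1/2) - conv (rect 1) (rect n) (x + 1/2)"
    unfolding conv_def
    by (intro Bochner_Integration.integral_diff bcs_integrable bcs_conv_integrand bcs_rect)
  finally show "conv (rect 1) (slope n) x = slope (Suc n) x"
    using assms by (simp add: slope_def rect_Suc del: One_nat_def)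
qed

lemma continuous_on_slope:
  assumes "2 \<le> n"
  shows "continuous_on UNIV (slope n)"
  unfolding slope_def[abs_def]
  by (intro continuous_on_diff continuous_on_compose2[OF continuous_on_rect[OF assms]] continuous_intros) auto

lemma ratio_antimono_slope_two: "ratio_antimono (slope 2)"
  unfolding ratio_antimono_def
proof (intro allI impI)
  fix x y :: real assume xy: "0 < x" "x \<le> y"
  have s: "slope 2 z = (if z \<le> 1/2 then 2 * z else max 0 (3/2 - z))" if "0 < z" for z
    using that by (auto simp: slope_def rect_two)
  show "x * slope 2 y \<le> y * slope 2 x"
  proof (cases "x \<le> 1/2")
    case True
    have "slope 2 y \<le> 2 * y" using xy by (simp add: s)
    then have "x * slope 2 y \<le> x * (2 * y)" using xy by (intro mult_left_mono) auto
    then show ?thesis using True xy by (simp add: s)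
  next
    case False
    then show ?thesis using xy by (intro mult_mono) (auto simp: s)
  qed
qed

lemma ratio_antimono_slope:
  assumes "1 \<le> m"
  shows "ratio_antimono (slope (2 * m))"
  using assms
proof (induction m rule: dec_induct)
  case base
  show ?case using ratio_antimono_slope_two by simp
next
  case (step m)
  have eq: "conv (rect 1) (conv (rect 1) (slope (2 * m))) = slope (2 * Suc m)"
    using step.hyps by (simp add: conv_rect_one_slope del: One_nat_def)
  have "slope (2 * Suc m) 0 = 0"
    using slope_minus[of "2 * Suc m" 0] by simp
  then show ?case
    using ratio_antimono_conv[of "slope (2 * m)"] step continuous_on_slope[of "2 * m"] slope_minus
    unfolding eq by simp
qed

text \<open>
  Since \<open>slope (2 * m) x / x\<close> is nonincreasing and vanishes for large \<open>x\<close>, it is nonnegative.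
\<close>

lemma slope_nonneg:
  assumes "1 \<le> m" "0 \<le> x"
  shows "0 \<le> slope (2 * m) x"
proof (cases "x = 0")
  case True
  then show ?thesis using slope_minus[of "2 * m" 0] by simp
next
  case False
  define y where "y = x + real m + 1"
  have "slope (2 * m) y = 0"
    using assms by (simp add: slope_def y_def rect_eq_0)
  moreover have "x * slope (2 * m) y \<le> y * slope (2 * m) x"
    using ratio_antimono_slope[OF assms(1)] False assms by (auto simp: ratio_antimono_def y_def)
  moreover have "0 < y" using assms by (simp add: y_def)
  ultimately show ?thesis by (simp add: zero_le_mult_iff)
qed

lemma slope_ge_linear:
  assumes "1 \<le> m" "\<bar>t\<bar> \<le> 1/2"
  shows "2 * t\<^sup>2 * slope (2 * m) (1/2) \<le> t * slope (2 * m) t"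
proof -
  have pos: "2 * t\<^sup>2 * slope (2 * m) (1/2) \<le> t * slope (2 * m) t" if "0 < t" "t \<le> 1/2" for t
  proof -
    have "t * slope (2 * m) (1/2) \<le> 1/2 * slope (2 * m) t"
      using ratio_antimono_slope[OF assms(1)] that unfolding ratio_antimono_def by blast
    then have "(2 * t) * (t * slope (2 * m) (1/2)) \<le> (2 * t) * (1/2 * slope (2 * m) t)"
      using that by (intro mult_left_mono) auto
    then show ?thesis by (simp add: power2_eq_square)
  qed
  consider "t = 0" | "0 < t" | "t < 0" by linarith
  then show ?thesis
    using pos[of t] pos[of "- t"] assms(2) by cases (auto simp: slope_minus)
qed

section \<open>Integrals over the central unit interval\<close>

lemma set_integral_unit_interval:
  "(LBINT t:{-1/2..1/2}. h t * f t) = (LBINT t. (h t * rect 1 t) * f t)"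
  unfolding set_lebesgue_integral_def rect_one
  by (intro Bochner_Integration.integral_cong refl) simp

lemma rect_at_0:
  assumes "1 \<le> n"
  shows "rect (Suc n) 0 = (LBINT t:{-1/2..1/2}. rect n t)"
  using conv_rect_one[of "rect n" 0] assms by (simp add: rect_Suc del: One_nat_def)

lemma set_integrable_unit_interval:
  fixes f :: "real \<Rightarrow> real"
  assumes "continuous_on UNIV f"
  shows "set_integrable lborel {-1/2..1/2} f"
  unfolding set_integrable_def
  by (intro borel_integrable_compact continuous_on_subset[OF assms]) auto

lemma conv_rect_x_rect:
  assumes "1 \<le> n"
  shows "conv rect_x (rect n) x = x * rect (Suc n) x / (real n + 1)"
  using fun_cong[OF ident_times_rect[OF assms], of x] by (simp add: add.commute)

lemma conv_rect_x_rect_diff: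
  assumes "1 \<le> n"
  shows "conv rect_x (rect n) (1/2) - conv rect_x (rect n) (-1/2) = rect (Suc n) (1/2) / (real n + 1)"
proof -
  have "rect (Suc n) (-1/2) = rect (Suc n) (1/2)" using rect_minus[of "Suc n" "1/2"] by simp
  moreover have "(1/2) * a / d - (-1/2) * a / d = a / d" for a d :: real
    by (cases "d = 0") (simp_all add: field_simps)
  ultimately show ?thesis unfolding conv_rect_x_rect[OF assms] by metis
qed

lemma integral_ident_slope:
  assumes "1 \<le> k"
  shows "(LBINT t:{-1/2..1/2}. t * slope (2 * k) t) = rect (2 * k + 1) (1/2) / (2 * real k + 1)"
proof -
  have "(LBINT t:{-1/2..1/2}. t * slope (2 * k) t) = (LBINT t. rect_x t * slope (2 * k) t)"
    by (simp only: set_integral_unit_interval rect_x_def)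
  also have "\<dots> = (LBINT t. rect_x t * rect (2 * k) (1/2 - t) - rect_x t * rect (2 * k) (-1/2 - t))"
  proof (intro Bochner_Integration.integral_cong refl)
    fix t
    show "rect_x t * slope (2 * k) t = rect_x t * rect (2 * k) (1/2 - t) - rect_x t * rect (2 * k) (-1/2 - t)"
      using rect_minus[of "2 * k" "1/2 - t"] rect_minus[of "2 * k" "-1/2 - t"]
      by (simp add: slope_def right_diff_distrib add.commute)
  qed
  also have "\<dots> = conv rect_x (rect (2 * k)) (1/2) - conv rect_x (rect (2 * k)) (-1/2)"
    unfolding conv_def
    by (intro Bochner_Integration.integral_diff bcs_integrable bcs_conv_integrand bcs_rect bcs_rect_x)
  also have "\<dots> = rect (2 * k + 1) (1/2) / (2 * real k + 1)"
    using assms conv_rect_x_rect_diff[of "2 * k"] by simp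
  finally show ?thesis .
qed

text \<open>
  Integration by parts of \<open>rect (2 * k + 1)\<close> over \<open>[-1/2, 1/2]\<close>. The remaining integral is given by
  \<open>integral_ident_slope\<close>.
\<close>

lemma rect_odd_at_half:
  assumes "1 \<le> k"
  shows "rect (2 * k + 1) (1/2) = (2 * real k + 1) / (2 * real k + 2) * rect (2 * k + 2) 0"
proof -
  define f where "f = rect (2 * k + 1)"
  have Df: "(f has_real_derivative - slope (2 * k) x) (at x)" for x
    using DERIV_rect[of "2 * k" x] assms by (simp add: f_def slope_def)
  have cf: "continuous_on UNIV f" unfolding f_def using assms by (intro continuous_on_rect) simp
  have cs: "continuous_on UNIV (slope (2 * k))" using assms by (intro continuous_on_slope) simp
  have "(LBINT t. (f t - t * slope (2 * k) t) * indicator {-1/2..1/2} t)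
      = (1/2) * f (1/2) - (-1/2) * f (-1/2)"
  proof (rule integral_FTC_Icc_real)
    show "((\<lambda>t. t * f t) has_real_derivative f t - t * slope (2 * k) t) (at t)" for t
      by (auto intro!: derivative_eq_intros Df)
    show "isCont (\<lambda>t. f t - t * slope (2 * k) t) t" for t
    proof -
      have "continuous_on UNIV (\<lambda>t. f t - t * slope (2 * k) t)"
        by (intro continuous_intros cf cs)
      then show ?thesis by (simp add: continuous_on_eq_continuous_at)
    qed
  qed simp
  moreover have "f (-1/2) = f (1/2)" using rect_minus[of "2 * k + 1" "1/2"] by (simp add: f_def)
  ultimately have "(LBINT t:{-1/2..1/2}. f t - t * slope (2 * k) t) = f (1/2)"
    by (simp add: set_lebesgue_integral_def mult.commute)
  moreover have "(LBINT t:{-1/2..1/2}. f t - t * slope (2 * k) t)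
      = (LBINT t:{-1/2..1/2}. f t) - (LBINT t:{-1/2..1/2}. t * slope (2 * k) t)"
    by (intro set_integral_diff set_integrable_unit_interval cf continuous_intros cs)
  moreover have "(LBINT t:{-1/2..1/2}. f t) = rect (2 * k + 2) 0"
    using rect_at_0[of "2 * k + 1"] by (simp add: f_def)
  ultimately have "rect (2 * k + 2) 0 - f (1/2) / (2 * real k + 1) = f (1/2)"
    using integral_ident_slope[OF assms] by (simp add: f_def)
  then show ?thesis
    unfolding f_def by (simp add: field_simps)
qed

text \<open>
  Among the odd functions \<open>g\<close> with \<open>g x / x\<close> nonincreasing and \<open>g (1/2)\<close> fixed, the integral of
  \<open>t * g t\<close> over \<open>[-1/2, 1/2]\<close> is smallest if \<open>g\<close> is linear.
\<close>

lemma slope_half_le: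
  assumes "1 \<le> k"
  shows "(real k + 1) * slope (2 * k) (1/2) \<le> 3 * rect (2 * k + 2) 0"
proof -
  have sq: "(LBINT t:{-1/2..1/2}. t\<^sup>2) = (1/12::real)"
  proof -
    have "(LBINT t. t\<^sup>2 * indicator {-1/2..1/2} t) = (1/2)^3/3 - (-1/2)^3/(3::real)"
      by (rule integral_FTC_Icc_real) (auto intro!: derivative_eq_intros)
    then show ?thesis by (simp add: set_lebesgue_integral_def mult.commute power3_eq_cube)
  qed
  have "slope (2 * k) (1/2) / 6 = (LBINT t:{-1/2..1/2}. 2 * slope (2 * k) (1/2) * t\<^sup>2)"
    unfolding set_integral_mult_right sq by simp
  also have "\<dots> \<le> (LBINT t:{-1/2..1/2}. t * slope (2 * k) t)"
  proof (rule set_integral_mono)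
    show "2 * slope (2 * k) (1/2) * t\<^sup>2 \<le> t * slope (2 * k) t" if "t \<in> {-1/2..1/2}" for t
    proof -
      have "\<bar>t\<bar> \<le> 1/2" using that by (auto simp: abs_le_iff)
      then show ?thesis using slope_ge_linear[OF assms, of t] by (simp add: mult_ac)
    qed
  qed (intro set_integrable_unit_interval continuous_intros continuous_on_slope; use assms in simp)+
  also have "\<dots> = rect (2 * k + 2) 0 / (2 * real k + 2)"
    using integral_ident_slope[OF assms] rect_odd_at_half[OF assms] by simp
  finally show ?thesis by (simp add: field_simps)
qed

lemma rect_odd_antimono:
  assumes "1 \<le> k" "0 \<le> x" "x \<le> y"
  shows "rect (2 * k + 1) y \<le> rect (2 * k + 1) x"
proof (rule DERIV_nonpos_imp_nonincreasing[OF assms(3)])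
  fix z assume "x \<le> z" "z \<le> y"
  then show "\<exists>d. (rect (2 * k + 1) has_real_derivative d) (at z) \<and> d \<le> 0"
    using DERIV_rect[of "2 * k" z] slope_nonneg[OF assms(1), of z] assms
    by (auto simp: slope_def)
qed

text \<open>
  The left side is the integral of \<open>t\<^sup>2 * rect (2 * k + 1) t\<close> over \<open>[-1/2, 1/2]\<close>. This is
  Chebyshev's integral inequality for the functions \<open>t\<^sup>2\<close>, whose mean is \<open>1/12\<close>, and \<open>rect (2 * k + 1)\<close>, which are
  oppositely ordered in \<open>\<bar>t\<bar>\<close>.
\<close>

lemma conv_rect_xx_le:
  assumes "1 \<le> k"
  shows "conv rect_xx (rect (2 * k + 1)) 0 \<le> rect (2 * k + 2) 0 / 12"
proof -
  define f where "f = rect (2 * k + 1)"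
  have cf: "continuous_on UNIV f" unfolding f_def using assms by (intro continuous_on_rect) simp
  have f_minus: "f (- t) = f t" for t by (simp add: f_def rect_minus)
  have f_abs: "f t = f \<bar>t\<bar>" for t by (simp add: abs_if f_minus)
  \<comment> \<open>The point where \<open>t\<^sup>2\<close> attains its mean.\<close>
  define c where "c = sqrt (1/12)"
  have c: "0 \<le> c" "c\<^sup>2 = 1/12" by (simp_all add: c_def)
  have sign: "(t\<^sup>2 - 1/12) * (f t - f c) \<le> 0" for t
  proof (cases "\<bar>t\<bar> \<le> c")
    case True
    then have "t\<^sup>2 \<le> c\<^sup>2" using c(1) by (simp add: abs_le_square_iff[symmetric])
    moreover have "f c \<le> f t" unfolding f_abs[of t] unfolding f_def
      using True by (intro rect_odd_antimono assms) auto
    ultimately show ?thesis using c by (intro mult_nonpos_nonneg) auto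
  next
    case False
    then have "c\<^sup>2 \<le> t\<^sup>2" using c(1) by (simp add: abs_le_square_iff[symmetric])
    moreover have "f t \<le> f c" unfolding f_abs[of t] unfolding f_def
      using False c by (intro rect_odd_antimono assms) auto
    ultimately show ?thesis using c by (intro mult_nonneg_nonpos) auto
  qed
  have "(LBINT t:{-1/2..1/2}. t\<^sup>2 * f t - 1/12 * f t) \<le> (LBINT t:{-1/2..1/2}. f c * (t\<^sup>2 - 1/12))"
  proof (rule set_integral_mono)
    show "t\<^sup>2 * f t - 1/12 * f t \<le> f c * (t\<^sup>2 - 1/12)" for t
      using sign[of t] by (simp add: algebra_simps diff_divide_distrib)
  qed (intro set_integrable_unit_interval continuous_intros cf)+
  also have "\<dots> = 0"
  proof -
    have "(LBINT t. (t\<^sup>2 - 1/12) * indicator {-1/2..1/2} t)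
        = ((1/2)^3/3 - (1/2)/12) - ((-1/2)^3/3 - (-1/2)/(12::real))"
      by (rule integral_FTC_Icc_real) (auto intro!: derivative_eq_intros continuous_intros)
    then show ?thesis by (simp add: set_lebesgue_integral_def mult.commute power3_eq_cube)
  qed
  also have "(LBINT t:{-1/2..1/2}. t\<^sup>2 * f t - 1/12 * f t)
      = (LBINT t:{-1/2..1/2}. t\<^sup>2 * f t) - (LBINT t:{-1/2..1/2}. 1/12 * f t)"
    by (intro set_integral_diff set_integrable_unit_interval cf continuous_intros)
  also have "(LBINT t:{-1/2..1/2}. 1/12 * f t) = rect (2 * k + 2) 0 / 12"
    using rect_at_0[of "2 * k + 1"] by (simp add: f_def)
  also have "(LBINT t:{-1/2..1/2}. t\<^sup>2 * f t) = conv rect_xx f 0"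
    unfolding set_integral_unit_interval conv_def
    by (intro Bochner_Integration.integral_cong refl) (simp add: rect_xx_def rect_x_def f_minus power2_eq_square)
  finally show ?thesis by (simp add: f_def)
qed

lemma rect_even_pos:
  assumes "1 \<le> p"
  shows "0 < rect (2 * p) 0"
proof -
  have "rect (2 * p) 0 \<noteq> 0"
  proof
    assume 0: "rect (2 * p) 0 = 0"
    have "integrable lborel (\<lambda>x. (rect p x)\<^sup>2)"
      using bcs_integrable[OF bcs_mult[OF bcs_rect bcs_rect]] by (simp add: power2_eq_square)
    then have "AE x in lborel. (rect p x)\<^sup>2 = 0"
      using integral_nonneg_eq_0_iff_AE[of lborel "\<lambda>x. (rect p x)\<^sup>2"] integral_rect_sq[OF assms] 0 by simp
    then have "AE x in lborel. rect p x = 0" by simp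
    then have "(LBINT x. rect p x) = 0"
      by (rule integral_eq_zero_AE)
    then show False using integral_rect[OF assms] by simp
  qed
  then show ?thesis using rect_nonneg[of "2 * p" 0] by simp
qed

section \<open>The uncertainty inequality\<close>

lemma integral_slope_sq:
  assumes "1 \<le> k"
  shows "(LBINT x. (slope k x)\<^sup>2) = 2 * slope (2 * k) (1/2)"
proof -
  define h where "h a b x = rect k (x + a) * rect k (x + b)" for a b x
  have i: "integrable lborel (h a b)" for a b
    unfolding h_def by (intro bcs_integrable bcs_mult bcs_shift bcs_rect)
  have c: "(LBINT x. h a b x) = rect (2 * k) (b - a)" for a b
  proof -
    have "(LBINT x. h a b x) = (LBINT x. rect k (x + a) * rect k (x + a + (b - a)))"
      by (simp add: h_def)
    also have "\<dots> = (LBINT x. rect k x * rect k (x + (b - a)))"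
      by (rule lborel_integral_shift)
    also have "\<dots> = conv (rect k) (rect k) (- (b - a))"
      unfolding conv_def
    proof (intro Bochner_Integration.integral_cong refl)
      fix x
      show "rect k x * rect k (x + (b - a)) = rect k x * rect k (- (b - a) - x)"
        using rect_minus[of k "x + (b - a)"] by (simp add: algebra_simps)
    qed
    also have "\<dots> = rect (2 * k) (b - a)"
      unfolding conv_rect_rect[OF assms assms] rect_minus by (simp add: mult_2)
    finally show ?thesis .
  qed
  have "(LBINT x. (slope k x)\<^sup>2)
      = (LBINT x. h (-1/2) (-1/2) x + h (1/2) (1/2) x - 2 * h (-1/2) (1/2) x)"
    by (intro Bochner_Integration.integral_cong refl) (simp add: slope_def h_def power2_eq_square algebra_simps)
  also have "\<dots> = 2 * slope (2 * k) (1/2)"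
    by (simp add: i c slope_def)
  finally show ?thesis .
qed

text \<open>
  For \<open>k \<ge> 2\<close> this is integration by parts, as \<open>slope k\<close> is then the negative derivative of
  \<open>rect (k + 1)\<close>. The algebraic derivation below also covers \<open>k = 1\<close>, where \<open>rect 2\<close> has kinks.
\<close>

lemma integral_ident_rect_slope:
  assumes "1 \<le> k"
  shows "(LBINT x. (x * rect (Suc k) x) * slope k x) = rect (2 * k + 2) 0 / 2"
proof -
  define m where "m = (\<lambda>x. x * rect (Suc k) x)"
  have m: "m = (\<lambda>x. real (Suc k) * conv rect_x (rect k) x)"
    unfolding m_def by (rule ident_times_rect[OF assms])
  have bm: "bcs m" unfolding m_def by (intro bcs_times_ident bcs_rect)
  have cm: "conv m (rect k) = (\<lambda>x. real (Suc k) * conv rect_x (rect (2 * k)) x)"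
    unfolding m conv_scale_left
    using conv_rect_rect[OF assms assms] by (simp add: conv_assoc bcs_rect bcs_rect_x mult_2)
  have "(LBINT x. m x * slope k x) = (LBINT x. m x * rect k (1/2 - x) - m x * rect k (-1/2 - x))"
  proof (intro Bochner_Integration.integral_cong refl)
    fix x
    show "m x * slope k x = m x * rect k (1/2 - x) - m x * rect k (-1/2 - x)"
      using rect_minus[of k "1/2 - x"] rect_minus[of k "-1/2 - x"]
      by (simp add: slope_def right_diff_distrib add.commute)
  qed
  also have "\<dots> = conv m (rect k) (1/2) - conv m (rect k) (-1/2)"
    unfolding conv_def
    by (intro Bochner_Integration.integral_diff bcs_integrable bcs_conv_integrand bcs_rect bm)
  also have "\<dots> = real (Suc k) * (rect (2 * k + 1) (1/2) / (2 * real k + 1))"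
    using conv_rect_x_rect_diff[of "2 * k"] assms unfolding cm right_diff_distrib[symmetric] by simp
  also have "\<dots> = rect (2 * k + 2) 0 / 2"
  proof -
    have "2 * real k + 1 \<noteq> 0" by linarith
    then show ?thesis
      unfolding rect_odd_at_half[OF assms] by (simp add: divide_simps)
  qed
  finally show ?thesis by (simp add: m_def)
qed

lemma cauchy_schwarz_bcs:
  assumes "bcs f" "bcs g"
  shows "(LBINT x. f x * g x)\<^sup>2 \<le> (LBINT x. (f x)\<^sup>2) * (LBINT x. (g x)\<^sup>2)"
proof -
  define N C G where "N = (LBINT x. (f x)\<^sup>2)" and "C = (LBINT x. f x * g x)" and "G = (LBINT x. (g x)\<^sup>2)"
  have i: "integrable lborel (\<lambda>x. (f x)\<^sup>2)" "integrable lborel (\<lambda>x. f x * g x)" "integrable lborel (\<lambda>x. (g x)\<^sup>2)"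
    using bcs_integrable[OF bcs_mult] assms by (auto simp: power2_eq_square)
  have q: "0 \<le> N - 2 * l * C + l\<^sup>2 * G" for l
  proof -
    have "0 \<le> (LBINT x. (f x - l * g x)\<^sup>2)" by simp
    also have "\<dots> = (LBINT x. (f x)\<^sup>2 - (2 * l) * (f x * g x) + l\<^sup>2 * (g x)\<^sup>2)"
      by (intro Bochner_Integration.integral_cong refl) (simp add: power2_eq_square algebra_simps)
    also have "\<dots> = N - 2 * l * C + l\<^sup>2 * G"
      by (simp add: i N_def C_def G_def)
    finally show ?thesis .
  qed
  have "0 \<le> G" by (simp add: G_def)
  show ?thesis
  proof (cases "G = 0")
    case True
    have "C = 0"
    proof (rule ccontr)
      assume "C \<noteq> 0"
      then show False using q[of "(N + 1) / (2 * C)"] True by simp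
    qed
    then show ?thesis using True by (simp add: N_def C_def G_def)
  next
    case False
    then show ?thesis using q[of "C / G"] \<open>0 \<le> G\<close>
      unfolding N_def[symmetric] C_def[symmetric] G_def[symmetric]
      by (simp add: field_simps power2_eq_square)
  qed
qed

section \<open>Bounds for the two variances\<close>

lemma nu_eq:
  assumes "1 \<le> k"
  shows "nu (Suc k) = 2 * slope (2 * k) (1/2) / rect (2 * k + 2) 0"
proof -
  have "nu (Suc k) = (LBINT \<omega>. \<omega>\<^sup>2 * hsinc \<omega> ^ (2 * Suc k)) / (LBINT \<omega>. hsinc \<omega> ^ (2 * Suc k))"
    by (simp only: nu_def hsinc_def)
  also have "\<dots> = 4 * pi * slope (2 * k) (1/2) / (2 * pi * rect (2 * k + 2) 0)"
    using hsinc_nu_numerator(1)[of "Suc k"] hsinc_nu_denominator[of "Suc k"] assms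
    by (simp add: slope_def)
  also have "\<dots> = 2 * slope (2 * k) (1/2) / rect (2 * k + 2) 0"
    by simp
  finally show ?thesis .
qed

lemma u_eq:
  assumes "1 \<le> p"
  shows "u p = (LBINT x. x\<^sup>2 * (rect p x)\<^sup>2) / rect (2 * p) 0"
proof -
  have "(LBINT x:{- real p / 2..real p / 2}. h x * \<bar>rect p x\<bar>\<^sup>2) = (LBINT x. h x * (rect p x)\<^sup>2)" for h :: "real \<Rightarrow> real"
    unfolding set_lebesgue_integral_def
  proof (intro Bochner_Integration.integral_cong refl)
    fix x
    show "indicator {- real p / 2..real p / 2} x *\<^sub>R (h x * \<bar>rect p x\<bar>\<^sup>2) = h x * (rect p x)\<^sup>2"
      using rect_eq_0[of p x] by (cases "\<bar>x\<bar> \<le> real p / 2") (auto simp: indicator_def abs_le_iff)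
  qed
  from this[of "\<lambda>x. x\<^sup>2"] this[of "\<lambda>x. 1"] show ?thesis
    using integral_rect_sq[OF assms] by (simp add: u_def)
qed

lemma nu_le:
  assumes "2 \<le> p"
  shows "nu p \<le> 6 / real p"
proof -
  obtain k where k: "p = Suc k" "1 \<le> k" using assms by (cases p) auto
  then show ?thesis
    using slope_half_le[OF k(2)] rect_even_pos[of "Suc k"] by (simp add: nu_eq field_simps)
qed

lemma u_le:
  assumes "2 \<le> p"
  shows "u p \<le> (real p + 1) / 24"
proof -
  obtain k where k: "p = Suc k" "1 \<le> k" using assms by (cases p) auto
  have pos: "0 < rect (2 * k + 2) 0" using rect_even_pos[of "Suc k"] by simp
  have "u p = (real k + 1)\<^sup>2 / (2 * real k + 1) * conv rect_xx (rect (2 * k + 1)) 0 / rect (2 * k + 2) 0"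
    using integral_sq_times_rect_sq[OF k(2)] by (simp add: u_eq k add.commute)
  also have "\<dots> \<le> (real k + 1)\<^sup>2 / (2 * real k + 1) * (rect (2 * k + 2) 0 / 12) / rect (2 * k + 2) 0"
    using pos conv_rect_xx_le[OF k(2)] by (intro divide_right_mono mult_left_mono) auto
  also have "\<dots> = (real k + 1)\<^sup>2 / (2 * real k + 1) / 12"
    using pos by simp
  also have "\<dots> \<le> (real p + 1) / 24"
    using k by (simp add: field_simps power2_eq_square)
  finally show ?thesis .
qed

text \<open>
  Heisenberg's inequality for \<open>rect p\<close>: the Cauchy-Schwarz inequality for \<open>x * rect p x\<close> and the
  derivative of \<open>rect p\<close>.
\<close>

lemma nu_times_u_ge:
  assumes "2 \<le> p"
  shows "1/4 \<le> nu p * u p"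
proof -
  obtain k where k: "p = Suc k" "1 \<le> k" using assms by (cases p) auto
  define b where "b = rect (2 * k + 2) 0"
  have pos: "0 < b" using rect_even_pos[of "Suc k"] by (simp add: b_def)
  have "(b / 2)\<^sup>2 \<le> (LBINT x. (x * rect (Suc k) x)\<^sup>2) * (LBINT x. (slope k x)\<^sup>2)"
    unfolding b_def integral_ident_rect_slope[OF k(2), symmetric]
    by (intro cauchy_schwarz_bcs bcs_times_ident bcs_rect bcs_slope)
  then have "b\<^sup>2 / 4 \<le> (LBINT x. x\<^sup>2 * (rect (Suc k) x)\<^sup>2) * (2 * slope (2 * k) (1/2))"
    unfolding integral_slope_sq[OF k(2)] by (simp add: power_mult_distrib power_divide)
  moreover have "nu p * u p
      = ((LBINT x. x\<^sup>2 * (rect (Suc k) x)\<^sup>2) * (2 * slope (2 * k) (1/2))) / b\<^sup>2"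
    using k pos by (simp add: nu_eq u_eq b_def power2_eq_square field_simps)
  moreover have "1/4 = b\<^sup>2 / 4 / b\<^sup>2" using pos by simp
  ultimately show ?thesis by (metis divide_right_mono zero_le_power2)
qed

text \<open>
  The means \<open>alpha\<close> and \<open>beta\<close> vanish by symmetry.
\<close>

lemma U_rect:
  assumes "2 \<le> p"
  shows "U (\<lambda>x. complex_of_real (rect p x)) = nu p * u p"
proof -
  define f where "f = (\<lambda>x. complex_of_real (rect p x))"
  define b where "b = rect (2 * p) 0"
  have pos: "0 < b" using rect_even_pos[of p] assms by (simp add: b_def)
  have cf: "(cmod (f x))\<^sup>2 = (rect p x)\<^sup>2" for x by (simp add: f_def)
  have L: "(L2norm f)\<^sup>2 = b"
    unfolding L2norm_def cf using integral_rect_sq[of p] assms pos by (simp add: b_def)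
  have "(LBINT x. x * (rect p x)\<^sup>2) = (LBINT x. (0 - x) * (rect p (0 - x))\<^sup>2)"
    by (rule lborel_integral_reflect[symmetric])
  then have "(LBINT x. x * (rect p x)\<^sup>2) = 0" by (simp add: rect_minus)
  then have "alpha f = 0" by (simp add: alpha_def cf)
  then have vt: "var_time f = u p"
    using assms by (simp add: var_time_def cf L u_eq b_def)
  have ff: "(cmod (fourier f \<omega>))\<^sup>2 = hsinc \<omega> ^ (2 * p)" if "\<omega> \<noteq> 0" for \<omega>
    using fourier_rect[OF that, of p] assms
    by (simp add: f_def norm_power power_mult[symmetric] mult.commute power_even_abs)
  have f1: "\<omega> * (cmod (fourier f \<omega>))\<^sup>2 = \<omega> * hsinc \<omega> ^ (2 * p)" for \<omega>
    by (cases "\<omega> = 0") (simp_all add: ff)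
  have f2: "\<omega>\<^sup>2 * (cmod (fourier f \<omega>))\<^sup>2 = \<omega>\<^sup>2 * hsinc \<omega> ^ (2 * p)" for \<omega>
    by (cases "\<omega> = 0") (simp_all add: ff)
  have "(LBINT \<omega>. \<omega> * hsinc \<omega> ^ (2 * p)) = (LBINT \<omega>. (0 - \<omega>) * hsinc (0 - \<omega>) ^ (2 * p))"
    by (rule lborel_integral_reflect[symmetric])
  then have "(LBINT \<omega>. \<omega> * hsinc \<omega> ^ (2 * p)) = 0" by (simp add: hsinc_minus)
  then have "beta f = 0" by (simp add: beta_def f1)
  then have "var_freq f = 1 / (2 * pi * b) * (LBINT \<omega>. \<omega>\<^sup>2 * hsinc \<omega> ^ (2 * p))"
    by (simp add: var_freq_def L f2)
  also have "\<dots> = (LBINT \<omega>. \<omega>\<^sup>2 * hsinc \<omega> ^ (2 * p)) / (LBINT \<omega>. hsinc \<omega> ^ (2 * p))"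
    using hsinc_nu_denominator[of p] assms by (simp add: b_def)
  also have "\<dots> = nu p" by (simp only: nu_def hsinc_def)
  finally show ?thesis using vt by (simp add: U_def f_def)
qed

lemma u_ge:
  assumes "2 \<le> p"
  shows "real p / 24 \<le> u p"
proof -
  have u0: "0 \<le> u p" unfolding u_eq[of p] using assms
    by (subst u_eq) (auto simp: rect_nonneg intro!: divide_nonneg_nonneg integral_nonneg_AE)
  have "1/4 \<le> nu p * u p" by (rule nu_times_u_ge[OF assms])
  also have "\<dots> \<le> 6 / real p * u p" using nu_le[OF assms] u0 by (rule mult_right_mono)
  finally show ?thesis using assms by (simp add: field_simps)
qed

lemma nu_ge:
  assumes "2 \<le> p"
  shows "6 / (real p + 1) \<le> nu p"
proof -
  have "0 < u p" using u_ge[OF assms] assms by (smt (verit) divide_pos_pos of_nat_0_less_iff pos2 less_le_trans)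
  moreover have "1/4 \<le> nu p * u p" by (rule nu_times_u_ge[OF assms])
  moreover from this have "0 < nu p * u p" by linarith
  ultimately have nu0: "0 \<le> nu p" by (simp add: zero_less_mult_iff)
  have "1/4 \<le> nu p * u p" by fact
  also have "\<dots> \<le> nu p * ((real p + 1) / 24)" using u_le[OF assms] nu0 by (rule mult_left_mono)
  finally show ?thesis by (simp add: field_simps)
qed

lemma sqrt_div_powr_three_halves:
  fixes y :: real
  assumes "0 < y"
  shows "sqrt y / y powr (3/2) = 1 / y"
proof -
  have "y powr (3/2) = y powr (1/2 + 1)" by simp
  also have "\<dots> = sqrt y * y" using assms by (simp only: powr_add powr_half_sqrt powr_one less_imp_le)
  finally show ?thesis using assms by simp
qed

lemma U_tendsto: "(\<lambda>p::nat. U (\<lambda>x. complex_of_real (rect p x))) \<longlonglongrightarrow> 1/4"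
proof (rule tendsto_sandwich)
  show "\<forall>\<^sub>F p in sequentially. 1/4 \<le> U (\<lambda>x. complex_of_real (rect p x))"
    by (rule eventually_sequentiallyI[of 2]) (simp add: U_rect nu_times_u_ge[simplified])
  show "\<forall>\<^sub>F p in sequentially. U (\<lambda>x. complex_of_real (rect p x)) \<le> 1/4 + 1/4 * inverse (real p)"
  proof (rule eventually_sequentiallyI[of 2])
    fix p :: nat assume p: "2 \<le> p"
    have "nu p * u p \<le> 6 / real p * ((real p + 1) / 24)"
      using nu_le[OF p] u_le[OF p] u_ge[OF p] p
      by (intro mult_mono) (auto intro: order_trans[rotated])
    also have "\<dots> = 1/4 + 1/4 * inverse (real p)" using p by (simp add: field_simps)
    finally show "U (\<lambda>x. complex_of_real (rect p x)) \<le> 1/4 + 1/4 * inverse (real p)"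
      using p by (simp add: U_rect)
  qed
  have "(\<lambda>p. 1/4 + 1/4 * inverse (real p)) \<longlonglongrightarrow> 1/4 + 1/4 * 0"
    by (intro tendsto_intros LIMSEQ_inverse_real_of_nat LIMSEQ_inverse_real_of_nat lim_inverse_n)
  then show "(\<lambda>p. 1/4 + 1/4 * inverse (real p)) \<longlonglongrightarrow> 1/4" by simp
qed simp

theorem theorem2p4:
  "(\<exists>c1 c2 c3 c4 d1 d2 d3 d4 :: real.
     (\<forall>c\<in>{c1, c2, c3, c4}. c \<noteq> 0 \<and> c > -2) \<and> c2 > c1 \<and> c4 > c3 \<and>
     (\<forall>p::nat. p \<ge> 2 \<longrightarrow>
        6 * (sqrt (real p + c2) / (real p + c4) powr (3/2)) \<le> nu p \<and>
        nu p \<le> 6 * (sqrt (real p + c1) / (real p + c3) powr (3/2))) \<and>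
     (\<forall>d\<in>{d1, d2, d3, d4}. d \<noteq> 0 \<and> d > -2) \<and> d2 > d1 \<and> d4 > d3 \<and>
     (\<forall>p::nat. p \<ge> 2 \<longrightarrow>
        sqrt ((real p + d2) * (real p + d3)) / 24 \<le> u p \<and>
        u p \<le> sqrt ((real p + d1) * (real p + d4)) / 24) \<and>
     (\<forall>p::nat. p \<ge> 2 \<longrightarrow>
        1/4 * (sqrt ((real p + d2) * (real p + d3) * (real p + c2)) / (real p + c4) powr (3/2))
          \<le> U (\<lambda>x. complex_of_real (rect p x)) \<and>
        U (\<lambda>x. complex_of_real (rect p x))
          \<le> 1/4 * (sqrt ((real p + d1) * (real p + d4) * (real p + c1)) / (real p + c3) powr (3/2)))) \<and>
   (\<lambda>p::nat. U (\<lambda>x. complex_of_real (rect p x))) \<longlonglongrightarrow> 1/4 \<and>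
   (INF p\<in>{2::nat..}. U (\<lambda>x. complex_of_real (rect p x))) = 1/4"
proof (intro conjI)
  let ?lo = "\<lambda>p. sqrt ((real p + -1/2) * (real p + -1/2))"
  let ?hi = "\<lambda>p. sqrt ((real p + -1) * (real p + 7))"
  have nu1: "6 * (sqrt (real p + 2) / (real p + 2) powr (3/2)) \<le> nu p" if "2 \<le> p" for p
  proof -
    have "6 * (sqrt (real p + 2) / (real p + 2) powr (3/2)) = 6 / (real p + 2)"
      by (simp add: sqrt_div_powr_three_halves)
    also have "\<dots> \<le> 6 / (real p + 1)" by (intro divide_left_mono) auto
    also have "\<dots> \<le> nu p" by (rule nu_ge[OF that])
    finally show ?thesis .
  qed
  have nu2: "nu p \<le> 6 * (sqrt (real p + -1) / (real p + -1) powr (3/2))" if "2 \<le> p" for p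
  proof -
    have "nu p \<le> 6 / real p" by (rule nu_le[OF that])
    also have "\<dots> \<le> 6 / (real p + -1)" using that by (intro divide_left_mono) auto
    also have "\<dots> = 6 * (sqrt (real p + -1) / (real p + -1) powr (3/2))"
      using that by (subst sqrt_div_powr_three_halves) auto
    finally show ?thesis .
  qed
  have u1: "?lo p / 24 \<le> u p" if "2 \<le> p" for p
  proof -
    have "?lo p = real p - 1/2" using that by (simp flip: power2_eq_square)
    then show ?thesis using u_ge[OF that] by simp
  qed
  have u2: "u p \<le> ?hi p / 24" if "2 \<le> p" for p
  proof -
    have "real p + 1 \<le> ?hi p"
      using that by (intro real_le_rsqrt) (simp add: power2_eq_square algebra_simps)
    then show ?thesis using u_le[OF that] by simp
  qed
  have nonneg: "0 \<le> nu p" "0 \<le> u p" if "2 \<le> p" for p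
  proof -
    have "0 \<le> 6 / (real p + 1)" "0 \<le> real p / 24" by simp_all
    then show "0 \<le> nu p" "0 \<le> u p"
      using nu_ge[OF that] u_ge[OF that] by linarith+
  qed
  have factor: "1/4 * (sqrt (a * b * c) / q) = (6 * (sqrt c / q)) * (sqrt (a * b) / 24)" for a b c q :: real
    by (simp add: real_sqrt_mult)
  have U1: "1/4 * (sqrt ((real p + -1/2) * (real p + -1/2) * (real p + 2)) / (real p + 2) powr (3/2))
      \<le> U (\<lambda>x. complex_of_real (rect p x))" if "2 \<le> p" for p
    unfolding U_rect[OF that] factor
    by (intro mult_mono nu1 u1 nonneg that) (auto intro!: divide_nonneg_nonneg mult_nonneg_nonneg)
  have U2: "U (\<lambda>x. complex_of_real (rect p x))
      \<le> 1/4 * (sqrt ((real p + -1) * (real p + 7) * (real p + -1)) / (real p + -1) powr (3/2))" if "2 \<le> p" for p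
    unfolding U_rect[OF that] factor
    using that by (intro mult_mono nu2 u2 nonneg) (auto intro!: divide_nonneg_nonneg mult_nonneg_nonneg)
  show "\<exists>c1 c2 c3 c4 d1 d2 d3 d4 :: real.
     (\<forall>c\<in>{c1, c2, c3, c4}. c \<noteq> 0 \<and> c > -2) \<and> c2 > c1 \<and> c4 > c3 \<and>
     (\<forall>p::nat. p \<ge> 2 \<longrightarrow>
        6 * (sqrt (real p + c2) / (real p + c4) powr (3/2)) \<le> nu p \<and>
        nu p \<le> 6 * (sqrt (real p + c1) / (real p + c3) powr (3/2))) \<and>
     (\<forall>d\<in>{d1, d2, d3, d4}. d \<noteq> 0 \<and> d > -2) \<and> d2 > d1 \<and> d4 > d3 \<and>
     (\<forall>p::nat. p \<ge> 2 \<longrightarrow>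
        sqrt ((real p + d2) * (real p + d3)) / 24 \<le> u p \<and>
        u p \<le> sqrt ((real p + d1) * (real p + d4)) / 24) \<and>
     (\<forall>p::nat. p \<ge> 2 \<longrightarrow>
        1/4 * (sqrt ((real p + d2) * (real p + d3) * (real p + c2)) / (real p + c4) powr (3/2))
          \<le> U (\<lambda>x. complex_of_real (rect p x)) \<and>
        U (\<lambda>x. complex_of_real (rect p x))
          \<le> 1/4 * (sqrt ((real p + d1) * (real p + d4) * (real p + c1)) / (real p + c3) powr (3/2)))"
    \<comment> \<open>The choices \<open>c1 = c3\<close>, \<open>c2 = c4\<close> and \<open>d2 = d3\<close> make the first three bounds rational functions of
      \<open>p\<close>; and \<open>d4 = 7\<close> is the value for which \<open>(p - 1) * (p + d4) \<ge> (p + 1)\<^sup>2\<close> is an equality at \<open>p = 2\<close>.\<close>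
    by (rule exI[of _ "-1"], rule exI[of _ 2], rule exI[of _ "-1"], rule exI[of _ 2],
        rule exI[of _ "-1"], rule exI[of _ "-1/2"], rule exI[of _ "-1/2"], rule exI[of _ 7],
        intro conjI allI impI nu1 nu2 u1 u2 U1 U2; simp)
  show lim: "(\<lambda>p::nat. U (\<lambda>x. complex_of_real (rect p x))) \<longlonglongrightarrow> 1/4"
    by (rule U_tendsto)
  have ge: "1/4 \<le> U (\<lambda>x. complex_of_real (rect p x))" if "2 \<le> p" for p
    unfolding U_rect[OF that] by (rule nu_times_u_ge[OF that])
  show "(INF p\<in>{2::nat..}. U (\<lambda>x. complex_of_real (rect p x))) = 1/4"
  proof (rule antisym)
    have bdd: "bdd_below ((\<lambda>p. U (\<lambda>x. complex_of_real (rect p x))) ` {2::nat..})"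
      by (rule bdd_belowI2[where m = "1/4"], rule ge, simp)
    show "1/4 \<le> (INF p\<in>{2::nat..}. U (\<lambda>x. complex_of_real (rect p x)))"
      by (rule cINF_greatest, simp, rule ge, simp)
    show "(INF p\<in>{2::nat..}. U (\<lambda>x. complex_of_real (rect p x))) \<le> 1/4"
    proof (rule LIMSEQ_le_const[OF lim], intro exI allI impI)
      fix p :: nat assume "2 \<le> p"
      then show "(INF p\<in>{2::nat..}. U (\<lambda>x. complex_of_real (rect p x))) \<le> U (\<lambda>x. complex_of_real (rect p x))"
        using bdd by (intro cINF_lower) auto
    qed
  qed
qed

end
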